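(* Let $S_n$ be any one of the following: the set $\mathcal{H}_n$ of self-adjoint (Hermitian) matrices in $\mathbb{C}_{n\times n}$ for each $n$, the set $\mathcal{U}_n$ of unitary matrices in $\mathbb{C}_{n\times n}$ for each $n$, or the set $\mathcal{N}_n$ of normal matrices in $\mathbb{C}_{n\times n}$ for each $n$. For every integer $k\ge 2$ and every $\epsilon>0$ there exists $\delta>0$ such that for every positive integer $n$ the following holds: if $A_1,\dots,A_k\in S_n$ satisfy $\|A_i\|_{tr}\le 1$ for all $i$ and $\|A_iA_j-A_jA_i\|_{tr}\le\delta$ for all $i,j$, then there exist $\tilde A_1,\dots,\tilde A_k\in S_n$ with $[\tilde A_i,\tilde A_j]=0$ for all $i,j$ and $\|A_i-\tilde A_i\|_{tr}\le\epsilon$ for all $i=1,\dots,k$.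
   Context: $\mathbb{C}_{n\times n}$ is the set of complex $n\times n$ matrices, $[X,Y]=XY-YX$, and $\|A\|_{tr}=\sqrt{\frac1n\sum_{j,k=1}^n|A_{j,k}|^2}$ is the normalized Hilbert-Schmidt norm. The number $\delta$ depends on $\epsilon$ (and on the number $k$ of matrices) but not on the dimension $n$. *)

theory Defs
  imports Complex_Main "Jordan_Normal_Form.Schur_Decomposition"
begin

text \<open>The dimension \<open>n\<close> is quantified inside the statement, after \<open>\<delta>\<close>, so matrices are those of
  Jordan_Normal_Form with carrier \<open>carrier_mat n n\<close>; there \<open>mat_adjoint\<close> is the conjugate transpose.\<close>

definition hermitian_matrices :: "nat \<Rightarrow> complex mat set" where
  "hermitian_matrices n = {A \<in> carrier_mat n n. mat_adjoint A = A}"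

definition unitary_matrices :: "nat \<Rightarrow> complex mat set" where
  "unitary_matrices n =
     {A \<in> carrier_mat n n. mat_adjoint A * A = 1\<^sub>m n \<and> A * mat_adjoint A = 1\<^sub>m n}"

definition normal_matrices :: "nat \<Rightarrow> complex mat set" where
  "normal_matrices n = {A \<in> carrier_mat n n. mat_adjoint A * A = A * mat_adjoint A}"

definition mat_commutator :: "complex mat \<Rightarrow> complex mat \<Rightarrow> complex mat" where
  "mat_commutator X Y = X * Y - Y * X"

text \<open>Meant for square matrices; the normalising dimension is read off from the argument.\<close>

definition tr_norm :: "complex mat \<Rightarrow> real" where
  "tr_norm A =
     sqrt (1 / real (dim_row A) * (\<Sum>j<dim_row A. \<Sum>k<dim_col A. (cmod (A $$ (j, k)))\<^sup>2))"

end

theory Submission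
  imports Defs "HOL-Analysis.Inner_Product" "HOL-Analysis.L2_Norm"
begin

text \<open>
  Let \<open>a\<close> be Hermitian with spectral projections \<open>p\<^sub>i\<close> and eigenvalues \<open>l\<^sub>i\<close>. Cut the spectrum into
  intervals of length \<open>\<eta>\<close> with randomly shifted end points and delete from \<open>x\<close> the blocks \<open>p\<^sub>i x p\<^sub>j\<close>
  whose eigenvalues lie in different intervals. The blocks are orthogonal and are separated with
  probability at most \<open>\<bar>l\<^sub>i - l\<^sub>j\<bar> / \<eta>\<close>, so by Cauchy-Schwarz the squared loss is on average at most
  \<open>\<parallel>x\<parallel> \<parallel>[a, x]\<parallel> / \<eta>\<close>, independently of the dimension. The result commutes exactly with the
  discretised \<open>a\<close>. For contractions the other commutators stay small, and one treats the matrices one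
  after another.

  Only the Hilbert-Schmidt norms are bounded, so Hermitian matrices \<open>A\<^sub>j\<close> are first reduced to
  contractions. Put \<open>g = (1 + \<Sum> A\<^sub>j\<^sup>2)\<^bsup>1/2\<^esup>\<close>. Pairing \<open>[g\<^sup>2, A\<^sub>j]\<close> with
  \<open>A\<^sub>j g\<^sup>-\<^sup>2 - g\<^sup>-\<^sup>1 A\<^sub>j g\<^sup>-\<^sup>1\<close> shows that cutting along random cells of \<open>ln g\<close> costs little. On each
  cell \<open>g\<close> is constant up to a factor, hence the pinched \<open>A\<^sub>j\<close> equal \<open>r a\<^sub>j\<close> with contractions \<open>a\<^sub>j\<close>
  and a weight \<open>r\<close> commuting with everything, and \<open>r [a\<^sub>i, a\<^sub>j]\<close> is small. The argument for
  contractions works verbatim with the weight \<open>r\<close>.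

  For normal \<open>N\<close> one has \<open>\<parallel>[N\<^sup>*, x]\<parallel> = \<parallel>[N, x]\<parallel>\<close>, so the real and imaginary parts of almost
  commuting normal matrices almost commute. For unitary matrices one replaces the commuting normal
  approximants by their polar parts, which are the nearest unitaries.
\<close>

subsection \<open>Hilbert-Schmidt algebras\<close>

text \<open>The model is complex matrices with the real part of the trace inner product. No unit is
  demanded, so that matrices of all sizes can share one type, and scalars are real because
  \<open>real_inner\<close> is a real class.\<close>

class hs_algebra = real_algebra + real_inner +
  fixes adj :: "'a \<Rightarrow> 'a"
  assumes adj_adj [simp]: "adj (adj x) = x"
    and adj_add [simp]: "adj (x + y) = adj x + adj y"
    and adj_mult [simp]: "adj (x * y) = adj y * adj x"
    and adj_scaleR [simp]: "adj (r *\<^sub>R x) = r *\<^sub>R adj x"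
    and inner_mult_adj_left: "inner (a * x) y = inner x (adj a * y)"
    and inner_adj [simp]: "inner (adj x) (adj y) = inner x y"
begin

lemma adj_zero [simp]: "adj 0 = 0"
  using adj_add[of 0 0] by simp

lemma adj_minus [simp]: "adj (- x) = - adj x"
proof -
  have "adj x + adj (- x) = 0" by (simp flip: adj_add)
  then show ?thesis by (rule minus_unique[symmetric])
qed

lemma adj_diff [simp]: "adj (x - y) = adj x - adj y"
  using adj_add[of x "- y"] by simp

lemma adj_sum: "adj (sum f A) = (\<Sum>x\<in>A. adj (f x))"
  by (cases "finite A", induct set: finite) simp_all

lemma inner_mult_adj_right: "inner (x * a) y = inner x (y * adj a)"
  using inner_adj[of "x * a" y] inner_mult_adj_left[of "adj a" "adj x" "adj y"] inner_adj[of x "y * adj a"]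
  by simp

lemma norm_adj [simp]: "norm (adj x) = norm x"
  by (simp add: norm_eq_sqrt_inner)

end

text \<open>The operator norm is expressed through left multiplication on the Hilbert-Schmidt space
  itself, which avoids vectors; for matrices it gives the usual bound.\<close>

definition op_bound :: "real \<Rightarrow> 'a::hs_algebra \<Rightarrow> bool" where
  "op_bound c a \<longleftrightarrow> (\<forall>x. norm (a * x) \<le> c * norm x)"

lemma op_boundD: "op_bound c a \<Longrightarrow> norm (a * x) \<le> c * norm x"
  by (simp add: op_bound_def)

text \<open>The squared norm of \<open>adj a * x\<close> is the inner product of \<open>x\<close>
  with \<open>a * (adj a * x)\<close>, so Cauchy-Schwarz leaves a common factor
  \<open>norm (adj a * x)\<close> to cancel.\<close>

lemma op_bound_adj:
  fixes a :: "'a::hs_algebra"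
  assumes "op_bound c a"
  shows "op_bound c (adj a)"
  unfolding op_bound_def
proof
  fix x
  have "(norm (adj a * x))\<^sup>2 = inner x (a * (adj a * x))"
    by (simp add: power2_norm_eq_inner inner_mult_adj_left)
  also have "\<dots> \<le> norm x * norm (a * (adj a * x))"
    by (rule norm_cauchy_schwarz)
  also have "\<dots> \<le> norm x * (c * norm (adj a * x))"
    by (intro mult_left_mono op_boundD assms) simp
  finally have *: "norm (adj a * x) * norm (adj a * x) \<le> (c * norm x) * norm (adj a * x)"
    by (simp add: power2_eq_square mult_ac)
  show "norm (adj a * x) \<le> c * norm x"
  proof (cases "norm (adj a * x) = 0")
    \<comment> \<open>The sign of \<open>c\<close> is not known here; the bound for \<open>a\<close>
      itself shows that \<open>c * norm x\<close> is nonnegative.\<close>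
    case True
    have "0 \<le> norm (a * x)" by simp
    also have "\<dots> \<le> c * norm x" by (rule op_boundD[OF assms])
    finally show ?thesis using True by simp
  next
    case False
    then show ?thesis using * by (simp add: mult_le_cancel_right)
  qed
qed

lemma op_bound_right:
  fixes a :: "'a::hs_algebra"
  assumes "op_bound c a"
  shows "norm (x * a) \<le> c * norm x"
  using op_boundD[OF op_bound_adj[OF assms], of "adj x"] norm_adj[of "x * a"] by simp

lemma op_bound_mult:
  assumes "op_bound c a" "op_bound d b" "0 \<le> c"
  shows "op_bound (c * d) (a * b)"
  unfolding op_bound_def
proof
  fix x
  have "norm (a * (b * x)) \<le> c * norm (b * x)" by (rule op_boundD[OF assms(1)])
  also have "\<dots> \<le> c * (d * norm x)" by (intro mult_left_mono op_boundD assms)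
  finally show "norm (a * b * x) \<le> c * d * norm x" by (simp add: mult.assoc)
qed

lemma op_bound_diff:
  assumes "op_bound c a" "op_bound d b"
  shows "op_bound (c + d) (a - b)"
  unfolding op_bound_def
proof
  fix x
  have "norm (a * x - b * x) \<le> norm (a * x) + norm (b * x)" by (rule norm_triangle_ineq4)
  also have "\<dots> \<le> c * norm x + d * norm x" by (intro add_mono op_boundD assms)
  finally show "norm ((a - b) * x) \<le> (c + d) * norm x" by (simp add: algebra_simps)
qed

subsection \<open>Families of orthogonal projections and pinchings\<close>

text \<open>A finite orthogonal resolution of \<open>e\<close>, which acts as the unit of its
  corner. Since \<open>e\<close> is a parameter, eigenprojections can be split off from it one at a
  time.\<close>

locale proj_family =
  fixes e :: "'a::hs_algebra" and I :: "'i set" and p :: "'i \<Rightarrow> 'a"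
  assumes fin: "finite I"
    and adj_p: "a \<in> I \<Longrightarrow> adj (p a) = p a"
    and p_mult: "a \<in> I \<Longrightarrow> b \<in> I \<Longrightarrow> p a * p b = (if a = b then p a else 0)"
    and sum_p: "sum p I = e"
begin

lemma p_mult_left: "a \<in> I \<Longrightarrow> b \<in> I \<Longrightarrow> p a * (p b * x) = (if a = b then p a * x else 0)"
  by (simp add: mult.assoc[symmetric] p_mult)

lemma p_idem [simp]: "a \<in> I \<Longrightarrow> p a * p a = p a" "a \<in> I \<Longrightarrow> p a * (p a * x) = p a * x"
  by (simp_all add: p_mult p_mult_left)

lemma adj_e: "adj e = e"
  unfolding sum_p[symmetric] by (simp add: adj_sum adj_p)

lemma p_e [simp]: "a \<in> I \<Longrightarrow> p a * e = p a"
  unfolding sum_p[symmetric] by (simp add: sum_distrib_left p_mult fin)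

lemma e_p [simp]: "a \<in> I \<Longrightarrow> e * p a = p a"
  unfolding sum_p[symmetric] by (simp add: sum_distrib_right p_mult fin)

lemma p_e_left [simp]: "a \<in> I \<Longrightarrow> p a * (e * x) = p a * x"
  by (simp add: mult.assoc[symmetric])

lemma e_x_eq_sum: "e * x = (\<Sum>a\<in>I. p a * x)"
  unfolding sum_p[symmetric] by (simp add: sum_distrib_right)

lemma x_e_eq_sum: "x * e = (\<Sum>a\<in>I. x * p a)"
  unfolding sum_p[symmetric] by (simp add: sum_distrib_left)

lemma e_idem: "e * e = e"
  using x_e_eq_sum[of e] by (simp add: sum_p)

lemma p_mult_sum: "a \<in> I \<Longrightarrow> p a * (\<Sum>b\<in>I. p b * z b) = p a * z a"
  by (simp add: sum_distrib_left p_mult_left fin)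

text \<open>Pythagoras: products of different projections vanish, so the summands are mutually
  orthogonal.\<close>

lemma norm_sum_sq: "(norm (\<Sum>a\<in>I. p a * z a))\<^sup>2 = (\<Sum>a\<in>I. (norm (p a * z a))\<^sup>2)"
proof -
  have "(norm (\<Sum>a\<in>I. p a * z a))\<^sup>2 = (\<Sum>a\<in>I. inner (p a * z a) (\<Sum>b\<in>I. p b * z b))"
    by (simp add: power2_norm_eq_inner inner_sum_left)
  also have "\<dots> = (\<Sum>a\<in>I. inner (p a * z a) (p a * z a))"
  proof (rule sum.cong[OF refl])
    fix a assume a: "a \<in> I"
    have "inner (p a * z a) (\<Sum>b\<in>I. p b * z b) = inner (z a) (p a * (\<Sum>b\<in>I. p b * z b))"
      by (simp add: inner_mult_adj_left adj_p a)
    also have "\<dots> = inner (z a) (p a * (p a * z a))"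
      using a by (simp add: p_mult_sum)
    finally show "inner (p a * z a) (\<Sum>b\<in>I. p b * z b) = inner (p a * z a) (p a * z a)"
      using a by (simp add: inner_mult_adj_left adj_p)
  qed
  finally show ?thesis by (simp add: power2_norm_eq_inner)
qed

lemma op_bound_e: "op_bound 1 e"
  unfolding op_bound_def
proof
  fix x
  have "(norm (e * x))\<^sup>2 = inner (e * x) x"
    by (simp add: power2_norm_eq_inner inner_mult_adj_left adj_e mult.assoc[symmetric] e_idem)
  also have "\<dots> \<le> norm (e * x) * norm x" by (rule norm_cauchy_schwarz)
  finally have "norm (e * x) * norm (e * x) \<le> norm x * norm (e * x)"
    by (simp add: power2_eq_square mult_ac)
  then show "norm (e * x) \<le> 1 * norm x"
    by (cases "norm (e * x) = 0") (auto simp add: mult_le_cancel_right)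
qed

lemma bessel: "(\<Sum>a\<in>I. (norm (p a * x))\<^sup>2) \<le> (norm x)\<^sup>2"
proof -
  have "(\<Sum>a\<in>I. (norm (p a * x))\<^sup>2) = (norm (e * x))\<^sup>2"
    unfolding e_x_eq_sum by (rule norm_sum_sq[symmetric])
  also have "\<dots> \<le> (norm x)\<^sup>2"
    using op_boundD[OF op_bound_e, of x] by (intro power_mono) auto
  finally show ?thesis .
qed

lemma corner_expand:
  assumes "e * x = x" "x * e = x"
  shows "x = (\<Sum>a\<in>I. \<Sum>b\<in>I. p a * x * p b)"
proof -
  have "x = e * x * e" using assms by simp
  also have "\<dots> = (\<Sum>a\<in>I. \<Sum>b\<in>I. p a * x * p b)"
    by (simp add: e_x_eq_sum x_e_eq_sum sum_distrib_right sum_distrib_left)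
       (rule sum.swap)
  finally show ?thesis .
qed

text \<open>The blocks \<open>p a * x * p b\<close> are mutually orthogonal and sum to
  \<open>x\<close>, so the inner product splits block by block.\<close>

lemma inner_parseval:
  assumes "e * x = x" "x * e = x"
  shows "inner x y = (\<Sum>a\<in>I. \<Sum>b\<in>I. inner (p a * x * p b) (p a * y * p b))"
proof -
  have "inner x y = (\<Sum>a\<in>I. \<Sum>b\<in>I. inner (p a * x * p b) y)"
    by (subst corner_expand[OF assms]) (simp add: inner_sum_left)
  also have "\<dots> = (\<Sum>a\<in>I. \<Sum>b\<in>I. inner (p a * x * p b) (p a * y * p b))"
  proof (intro sum.cong refl)
    fix a b assume ab: "a \<in> I" "b \<in> I"
    have "inner (p a * x * p b) y = inner ((p a * (p a * x * p b)) * p b) y"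
      using ab by (simp add: mult.assoc)
    also have "\<dots> = inner (p a * x * p b) (p a * y * p b)"
      by (subst inner_mult_adj_right, subst inner_mult_adj_left) (simp add: ab adj_p mult.assoc)
    finally show "inner (p a * x * p b) y = inner (p a * x * p b) (p a * y * p b)" .
  qed
  finally show ?thesis .
qed

lemma norm_parseval:
  assumes "e * x = x" "x * e = x"
  shows "(norm x)\<^sup>2 = (\<Sum>a\<in>I. \<Sum>b\<in>I. (norm (p a * x * p b))\<^sup>2)"
  using inner_parseval[OF assms, of x] by (simp add: power2_norm_eq_inner)

lemma corner_eqI:
  assumes "e * x = x" "x * e = x" "e * y = y" "y * e = y"
    and "\<And>a b. a \<in> I \<Longrightarrow> b \<in> I \<Longrightarrow> p a * x * p b = p a * y * p b"
  shows "x = y"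
  using corner_expand[OF assms(1,2)] corner_expand[OF assms(3,4)] assms(5) by (simp cong: sum.cong)

section \<open>Functional calculus along the projections\<close>

definition fc :: "('i \<Rightarrow> real) \<Rightarrow> 'a" where
  "fc f = (\<Sum>a\<in>I. f a *\<^sub>R p a)"

lemma p_fc: "a \<in> I \<Longrightarrow> p a * fc f = f a *\<^sub>R p a"
  by (simp add: fc_def sum_distrib_left p_mult fin if_distrib cong: if_cong)

lemma fc_p: "a \<in> I \<Longrightarrow> fc f * p a = f a *\<^sub>R p a"
  by (simp add: fc_def sum_distrib_right p_mult fin if_distrib cong: if_cong)

lemma adj_fc [simp]: "adj (fc f) = fc f"
  by (simp add: fc_def adj_sum adj_p)

lemma fc_mult: "fc f * fc g = fc (\<lambda>a. f a * g a)"
  by (simp add: fc_def[of f] sum_distrib_right p_fc) (simp add: fc_def)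

lemma fc_diff: "fc f - fc g = fc (\<lambda>a. f a - g a)"
  by (simp add: fc_def sum_subtractf scaleR_diff_left)

lemma fc_one: "fc (\<lambda>a. 1) = e"
  by (simp add: fc_def sum_p)

lemma fc_cong: "(\<And>a. a \<in> I \<Longrightarrow> f a = g a) \<Longrightarrow> fc f = fc g"
  by (simp add: fc_def)

lemma e_fc [simp]: "e * fc f = fc f" "fc f * e = fc f"
  using fc_mult[of "\<lambda>_. 1" f] fc_mult[of f "\<lambda>_. 1"] by (simp_all add: fc_one)

lemma op_bound_fc:
  assumes "\<And>a. a \<in> I \<Longrightarrow> \<bar>f a\<bar> \<le> c" "0 \<le> c"
  shows "op_bound c (fc f)"
  unfolding op_bound_def
proof
  fix x
  have "(norm (fc f * x))\<^sup>2 = (norm (\<Sum>a\<in>I. p a * (f a *\<^sub>R x)))\<^sup>2"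
    by (simp add: fc_def sum_distrib_right)
  also have "\<dots> = (\<Sum>a\<in>I. (f a)\<^sup>2 * (norm (p a * x))\<^sup>2)"
    by (subst norm_sum_sq) (simp add: power_mult_distrib)
  also have "\<dots> \<le> (\<Sum>a\<in>I. c\<^sup>2 * (norm (p a * x))\<^sup>2)"
    using assms by (intro sum_mono mult_right_mono) (auto simp: abs_le_square_iff[symmetric])
  also have "\<dots> \<le> c\<^sup>2 * (norm x)\<^sup>2"
    unfolding sum_distrib_left[symmetric] by (intro mult_left_mono bessel) simp
  finally have "(norm (fc f * x))\<^sup>2 \<le> (c * norm x)\<^sup>2" by (simp add: power_mult_distrib)
  then show "norm (fc f * x) \<le> c * norm x"
    by (rule power2_le_imp_le) (use assms in simp)
qed

text \<open>Commuting with \<open>fc f\<close> kills every block of \<open>y\<close> that joins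
  different values of \<open>f\<close>; on the remaining blocks \<open>g\<close> takes equal values
  too, because it factors through \<open>f\<close>.\<close>

lemma commute_fc:
  assumes "y * fc f = fc f * y" "e * y = y" "y * e = y"
    and "\<And>a b. a \<in> I \<Longrightarrow> b \<in> I \<Longrightarrow> f a = f b \<Longrightarrow> g a = g b"
  shows "y * fc g = fc g * y"
proof (rule corner_eqI)
  fix a b assume ab: "a \<in> I" "b \<in> I"
  have "p a * (y * fc f) * p b = f b *\<^sub>R (p a * y * p b)"
    using ab by (simp add: mult.assoc fc_p)
  moreover have "p a * (fc f * y) * p b = f a *\<^sub>R (p a * y * p b)"
    using ab by (simp add: mult.assoc[symmetric] p_fc)
  ultimately have "f b *\<^sub>R (p a * y * p b) = f a *\<^sub>R (p a * y * p b)"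
    unfolding assms(1) by (rule trans[OF sym])
  then have "g b *\<^sub>R (p a * y * p b) = g a *\<^sub>R (p a * y * p b)"
    using assms(4)[OF ab] by (cases "p a * y * p b = 0") auto
  moreover have "p a * (y * fc g) * p b = g b *\<^sub>R (p a * y * p b)"
    using ab by (simp add: mult.assoc fc_p)
  moreover have "p a * (fc g * y) * p b = g a *\<^sub>R (p a * y * p b)"
    using ab by (simp add: mult.assoc[symmetric] p_fc)
  ultimately show "p a * (y * fc g) * p b = p a * (fc g * y) * p b" by simp
next
  show "e * (y * fc g) = y * fc g" using assms(2) by (simp add: mult.assoc[symmetric])
  show "e * (fc g * y) = fc g * y" by (simp add: mult.assoc[symmetric])
  show "y * fc g * e = y * fc g" by (simp add: mult.assoc)
  show "fc g * y * e = fc g * y" using assms(3) by (simp add: mult.assoc)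
qed

text \<open>The block diagonal part. It is the orthogonal projection onto those elements of the
  corner that commute with all \<open>p a\<close>.\<close>

definition pinch :: "'a \<Rightarrow> 'a" where
  "pinch x = (\<Sum>a\<in>I. p a * x * p a)"

lemma p_pinch: "a \<in> I \<Longrightarrow> p a * pinch x = p a * x * p a"
  using p_mult_sum[of a "\<lambda>b. x * p b"] by (simp add: pinch_def mult.assoc)

lemma pinch_p: "a \<in> I \<Longrightarrow> pinch x * p a = p a * x * p a"
  by (simp add: pinch_def sum_distrib_right mult.assoc p_mult if_distrib fin cong: if_cong)

lemma pinch_commute_p: "a \<in> I \<Longrightarrow> pinch x * p a = p a * pinch x"
  by (simp add: p_pinch pinch_p)

lemma adj_pinch: "adj (pinch x) = pinch (adj x)"
  by (simp add: pinch_def adj_sum adj_p mult.assoc)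

lemma pinch_diff: "pinch (x - y) = pinch x - pinch y"
  by (simp add: pinch_def algebra_simps sum_subtractf)

lemma e_pinch [simp]: "e * pinch x = pinch x" "pinch x * e = pinch x"
  by (simp_all add: pinch_def sum_distrib_left sum_distrib_right mult.assoc)
     (simp_all add: mult.assoc[symmetric])

lemma pinch_mult_left:
  assumes "\<And>a. a \<in> I \<Longrightarrow> y * p a = p a * y"
  shows "pinch (y * x) = y * pinch x"
  using assms by (simp add: pinch_def sum_distrib_left mult.assoc[symmetric])

lemma pinch_mult_right:
  assumes "\<And>a. a \<in> I \<Longrightarrow> y * p a = p a * y"
  shows "pinch (x * y) = pinch x * y"
  using assms by (simp add: pinch_def sum_distrib_right mult.assoc)

lemma pinch_commuting:
  assumes "\<And>a. a \<in> I \<Longrightarrow> y * p a = p a * y" "y * e = y"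
  shows "pinch y = y"
proof -
  have "pinch y = (\<Sum>a\<in>I. y * p a)"
    unfolding pinch_def using assms(1)
    by (intro sum.cong refl) (simp add: mult.assoc flip: assms(1))
  then show ?thesis using assms(2) by (simp add: x_e_eq_sum)
qed

lemma commute_pinch:
  assumes "\<And>a. a \<in> I \<Longrightarrow> y * p a = p a * y" "y * x = x * y"
  shows "y * pinch x = pinch x * y"
  using pinch_mult_left[of y x] pinch_mult_right[of y x] assms by simp

lemma inner_pinch: "inner (pinch x) y = inner x (pinch y)"
proof -
  have "inner (p a * x * p a) y = inner x (p a * y * p a)" if "a \<in> I" for a
    by (subst inner_mult_adj_right, subst inner_mult_adj_left) (simp add: that adj_p mult.assoc)
  then show ?thesis by (simp add: pinch_def inner_sum_left inner_sum_right)
qed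

text \<open>The pieces \<open>p a * y\<close> of the input and the pieces of the output are
  orthogonal families, so the bound for \<open>x\<close> can be applied piecewise and summed by
  Pythagoras and Bessel.\<close>

lemma op_bound_pinch:
  assumes "op_bound c x" "0 \<le> c"
  shows "op_bound c (pinch x)"
  unfolding op_bound_def
proof
  fix y
  have "(norm (pinch x * y))\<^sup>2 = (norm (\<Sum>a\<in>I. p a * (x * (p a * y))))\<^sup>2"
    by (simp add: pinch_def sum_distrib_right mult.assoc)
  also have "\<dots> = (\<Sum>a\<in>I. (norm (p a * (x * (p a * y))))\<^sup>2)" by (rule norm_sum_sq)
  also have "\<dots> \<le> (\<Sum>a\<in>I. c\<^sup>2 * (norm (p a * y))\<^sup>2)"
  proof (rule sum_mono)
    fix a assume a: "a \<in> I"
    have "(norm (p a * (x * (p a * y))))\<^sup>2 \<le> (\<Sum>b\<in>I. (norm (p b * (x * (p a * y))))\<^sup>2)"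
      by (rule member_le_sum[OF a _ fin]) simp
    also have "\<dots> \<le> (norm (x * (p a * y)))\<^sup>2" by (rule bessel)
    also have "\<dots> \<le> (c * norm (p a * y))\<^sup>2" by (intro power_mono op_boundD assms) simp
    finally show "(norm (p a * (x * (p a * y))))\<^sup>2 \<le> c\<^sup>2 * (norm (p a * y))\<^sup>2"
      by (simp add: power_mult_distrib)
  qed
  also have "\<dots> \<le> c\<^sup>2 * (norm y)\<^sup>2"
    unfolding sum_distrib_left[symmetric] by (intro mult_left_mono bessel) simp
  finally have "(norm (pinch x * y))\<^sup>2 \<le> (c * norm y)\<^sup>2" by (simp add: power_mult_distrib)
  then show "norm (pinch x * y) \<le> c * norm y"
    by (rule power2_le_imp_le) (use assms in simp)
qed

section \<open>Coarsening a family by merging equal labels\<close>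

definition cell :: "('i \<Rightarrow> 'k) \<Rightarrow> 'k \<Rightarrow> 'a" where
  "cell c i = (\<Sum>a\<in>{a\<in>I. c a = i}. p a)"

lemma cell_eq_fc: "cell c i = fc (\<lambda>a. if c a = i then 1 else 0)"
  unfolding cell_def fc_def by (subst sum.inter_filter[OF fin]) (auto intro!: sum.cong)

lemma proj_family_cell: "proj_family e (c ` I) (cell c)"
proof
  show "finite (c ` I)" by (simp add: fin)
  show "adj (cell c i) = cell c i" for i by (simp add: cell_eq_fc)
  show "cell c i * cell c j = (if i = j then cell c i else 0)" for i j
    unfolding cell_eq_fc fc_mult by (auto simp: fc_def intro!: sum.cong sum.neutral)
  show "sum (cell c) (c ` I) = e"
    unfolding cell_def sum_p[symmetric] by (rule sum.image_gen[OF fin, symmetric])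
qed

lemma p_cell: "a \<in> I \<Longrightarrow> p a * cell c i = (if c a = i then p a else 0)"
  by (simp add: cell_eq_fc p_fc)

lemma cell_p: "a \<in> I \<Longrightarrow> cell c i * p a = (if c a = i then p a else 0)"
  by (simp add: cell_eq_fc fc_p)

text \<open>Pinching along the cells deletes exactly the blocks whose labels differ and keeps the
  others unchanged, so Parseval gives the loss.\<close>

lemma norm_diff_pinch_cell:
  assumes "e * x = x" "x * e = x"
  shows "(norm (x - proj_family.pinch (c ` I) (cell c) x))\<^sup>2 =
    (\<Sum>a\<in>I. \<Sum>b\<in>I. if c a = c b then 0 else (norm (p a * x * p b))\<^sup>2)"
proof -
  interpret C: proj_family e "c ` I" "cell c" by (rule proj_family_cell)
  have *: "p a * (x - C.pinch x) * p b = (if c a = c b then 0 else p a * x * p b)"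
    if ab: "a \<in> I" "b \<in> I" for a b
  proof -
    have "p a * C.pinch x * p b = (\<Sum>i\<in>c ` I. (p a * cell c i) * x * (cell c i * p b))"
      by (simp add: C.pinch_def sum_distrib_left sum_distrib_right mult.assoc)
    also have "\<dots> = (\<Sum>i\<in>c ` I. if i = c a then (if c a = c b then p a * x * p b else 0) else 0)"
      using ab by (intro sum.cong refl) (simp add: p_cell cell_p)
    also have "\<dots> = (if c a = c b then p a * x * p b else 0)"
      using ab fin by simp
    finally show ?thesis by (simp add: right_diff_distrib left_diff_distrib)
  qed
  have "(norm (x - C.pinch x))\<^sup>2 = (\<Sum>a\<in>I. \<Sum>b\<in>I. (norm (p a * (x - C.pinch x) * p b))\<^sup>2)"
    by (rule norm_parseval) (simp_all add: algebra_simps assms)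
  also have "\<dots> = (\<Sum>a\<in>I. \<Sum>b\<in>I. if c a = c b then 0 else (norm (p a * x * p b))\<^sup>2)"
    by (intro sum.cong refl) (simp add: *)
  finally show ?thesis .
qed

end

section \<open>Counting the grid shifts that separate two points\<close>

lemma sum_floor_shift:
  fixes x :: real and M m :: nat
  assumes "M > 0"
  shows "(\<Sum>s<M. \<lfloor>x + real m / real M + real s / real M\<rfloor>) = (\<Sum>s<M. \<lfloor>x + real s / real M\<rfloor>) + int m"
proof (induction m)
  case 0
  then show ?case by simp
next
  case (Suc m)
  let ?g = "\<lambda>s. \<lfloor>x + real m / real M + real s / real M\<rfloor>"
  \<comment> \<open>Moving by \<open>1 / M\<close> shifts the sample points by one place: the first
    one drops out and the new last one is the old first one plus 1.\<close>
  have "(\<Sum>s<M. \<lfloor>x + real (Suc m) / real M + real s / real M\<rfloor>) = (\<Sum>s<M. ?g (Suc s))"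
    by (intro sum.cong refl arg_cong[where f = floor]) (simp add: add_divide_distrib)
  also have "\<dots> = (\<Sum>s<M. ?g s) + ?g M - ?g 0"
    using sum.lessThan_Suc_shift[of ?g M] sum.lessThan_Suc[of ?g M] by linarith
  also have "?g M = ?g 0 + 1"
    using assms by simp
  finally show ?case using Suc.IH by simp
qed

text \<open>For \<open>x \<le> y\<close> the indicator of separation is at most the difference of
  the two floors. Enlarging \<open>y\<close> to \<open>x + m / M\<close> makes the sum of these
  differences exactly \<open>m\<close>.\<close>

lemma card_floor_separated_le:
  fixes x y :: real and M :: nat
  assumes "M > 0"
  shows "(\<Sum>s<M. if \<lfloor>x + real s / real M\<rfloor> = \<lfloor>y + real s / real M\<rfloor> then 0 else 1) \<le> real M * \<bar>x - y\<bar> + 1"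
proof -
  have *: "(\<Sum>s<M. if \<lfloor>x + real s / real M\<rfloor> = \<lfloor>y + real s / real M\<rfloor> then 0 else 1) \<le> real M * (y - x) + 1"
    if xy: "x \<le> y" for x y :: real
  proof -
    \<comment> \<open>The number of steps of length \<open>1 / M\<close> that cover the gap;
      rounding up is the source of the additive 1.\<close>
    define m where "m = nat \<lceil>real M * (y - x)\<rceil>"
    have m: "real M * (y - x) \<le> real m" "real m \<le> real M * (y - x) + 1"
      unfolding m_def using xy by (auto simp: of_nat_nat intro: real_nat_ceiling_ge)
    have y: "y \<le> x + real m / real M"
      using m(1) assms by (simp add: field_simps)
    have "(\<Sum>s<M. if \<lfloor>x + real s / real M\<rfloor> = \<lfloor>y + real s / real M\<rfloor> then 0 else 1 :: real)
        \<le> (\<Sum>s<M. real_of_int (\<lfloor>y + real s / real M\<rfloor> - \<lfloor>x + real s / real M\<rfloor>))"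
    proof (rule sum_mono)
      fix s
      have "\<lfloor>x + real s / real M\<rfloor> \<le> \<lfloor>y + real s / real M\<rfloor>"
        using xy by (intro floor_mono) simp
      then show "(if \<lfloor>x + real s / real M\<rfloor> = \<lfloor>y + real s / real M\<rfloor> then 0 else 1 :: real)
        \<le> real_of_int (\<lfloor>y + real s / real M\<rfloor> - \<lfloor>x + real s / real M\<rfloor>)" by auto
    qed
    also have "\<dots> \<le> (\<Sum>s<M. real_of_int (\<lfloor>x + real m / real M + real s / real M\<rfloor> - \<lfloor>x + real s / real M\<rfloor>))"
      using y by (intro sum_mono) (simp add: floor_mono)
    also have "\<dots> = real_of_int ((\<Sum>s<M. \<lfloor>x + real m / real M + real s / real M\<rfloor>) - (\<Sum>s<M. \<lfloor>x + real s / real M\<rfloor>))"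
      by (simp add: sum_subtractf)
    also have "\<dots> = real m"
      unfolding sum_floor_shift[OF assms] by simp
    finally show ?thesis using m(2) by simp
  qed
  show ?thesis
  proof (cases "x \<le> y")
    case True
    then show ?thesis using *[OF True] by (simp add: abs_real_def)
  next
    case False
    then show ?thesis using *[of y x] by (simp add: abs_real_def eq_commute[of "\<lfloor>x + _\<rfloor>"])
  qed
qed

section \<open>Choosing one shift for finitely many elements\<close>

context proj_family
begin

text \<open>Taking the commutator with \<open>fc f\<close> multiplies the block at
  \<open>(a, b)\<close> by \<open>f a - f b\<close>.\<close>

lemma norm_commutator_fc:
  assumes "e * x = x" "x * e = x"
  shows "(norm (fc f * x - x * fc f))\<^sup>2 = (\<Sum>a\<in>I. \<Sum>b\<in>I. (f a - f b)\<^sup>2 * (norm (p a * x * p b))\<^sup>2)"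
proof -
  have *: "p a * (fc f * x - x * fc f) * p b = (f a - f b) *\<^sub>R (p a * x * p b)" if "a \<in> I" "b \<in> I" for a b
  proof -
    have "p a * (fc f * x - x * fc f) * p b = (p a * fc f) * x * p b - p a * x * (fc f * p b)"
      by (simp add: algebra_simps)
    then show ?thesis using that by (simp add: p_fc fc_p algebra_simps)
  qed
  have "e * (fc f * x) = fc f * x" "x * fc f * e = x * fc f" "e * (x * fc f) = x * fc f" "fc f * x * e = fc f * x"
    using assms by (simp_all add: mult.assoc) (simp_all add: mult.assoc[symmetric] assms)
  then have "(norm (fc f * x - x * fc f))\<^sup>2 = (\<Sum>a\<in>I. \<Sum>b\<in>I. (norm (p a * (fc f * x - x * fc f) * p b))\<^sup>2)"
    by (intro norm_parseval) (simp_all add: left_diff_distrib right_diff_distrib)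
  then show ?thesis by (simp add: * power_mult_distrib cong: sum.cong)
qed

text \<open>Cauchy-Schwarz over pairs of indices, with one factor \<open>norm x\<close> and the
  other the norm of the commutator of \<open>x\<close> with \<open>fc l\<close>. This replaces a
  quadratic weight by the linear one that matches the separation probability.\<close>

lemma sum_weighted_abs_le:
  assumes "e * x = x" "x * e = x"
    and "norm x \<le> B" and "(\<Sum>a\<in>I. \<Sum>b\<in>I. (l a - l b)\<^sup>2 * (norm (p a * x * p b))\<^sup>2) \<le> D\<^sup>2" and "0 \<le> D"
  shows "(\<Sum>a\<in>I. \<Sum>b\<in>I. \<bar>l a - l b\<bar> * (norm (p a * x * p b))\<^sup>2) \<le> B * D"
proof -
  let ?w = "\<lambda>(a, b). norm (p a * x * p b)"
  let ?d = "\<lambda>(a, b). (l a - l b) * norm (p a * x * p b)"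
  have "(\<Sum>a\<in>I. \<Sum>b\<in>I. \<bar>l a - l b\<bar> * (norm (p a * x * p b))\<^sup>2) = (\<Sum>z\<in>I \<times> I. \<bar>?w z\<bar> * \<bar>?d z\<bar>)"
    by (simp add: sum.cartesian_product abs_mult power2_eq_square case_prod_unfold mult_ac)
  also have "\<dots> \<le> L2_set ?w (I \<times> I) * L2_set ?d (I \<times> I)" by (rule L2_set_mult_ineq)
  also have "\<dots> \<le> B * D"
  proof (rule mult_mono)
    have "L2_set ?w (I \<times> I) = norm x"
      unfolding L2_set_def
      by (rule real_sqrt_unique) (simp_all add: norm_parseval[OF assms(1,2)] sum.cartesian_product case_prod_unfold)
    then show "L2_set ?w (I \<times> I) \<le> B" using assms(3) by simp
    have "(\<Sum>z\<in>I \<times> I. (?d z)\<^sup>2) \<le> D\<^sup>2"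
      using assms(4) by (simp add: sum.cartesian_product case_prod_unfold power_mult_distrib)
    then show "L2_set ?d (I \<times> I) \<le> D"
      unfolding L2_set_def using assms(5) by (rule real_le_lsqrt[rotated])
    show "0 \<le> B" using assms(3) norm_ge_zero[of x] by linarith
  qed (rule L2_set_nonneg)
  finally show ?thesis .
qed

text \<open>A random translate of the unit grid separates labels \<open>l a\<close>, \<open>l b\<close> with probability at most
  \<open>\<bar>l a - l b\<bar>\<close>; averaging over \<open>M\<close> equidistant translates costs an additional \<open>1 / M\<close>.\<close>

lemma exists_good_pinching:
  fixes x :: "'j \<Rightarrow> 'a" and l :: "'i \<Rightarrow> real"
  assumes J: "finite J" and M: "M > 0" and "0 \<le> D"
    and corner: "\<And>j. j \<in> J \<Longrightarrow> e * x j = x j" "\<And>j. j \<in> J \<Longrightarrow> x j * e = x j"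
    and B: "\<And>j. j \<in> J \<Longrightarrow> norm (x j) \<le> B"
    and D: "\<And>j. j \<in> J \<Longrightarrow> (\<Sum>a\<in>I. \<Sum>b\<in>I. (l a - l b)\<^sup>2 * (norm (p a * x j * p b))\<^sup>2) \<le> D\<^sup>2"
  obtains t :: real where "0 \<le> t" "t < 1"
    and "\<And>j. j \<in> J \<Longrightarrow> (norm (x j - proj_family.pinch ((\<lambda>a. \<lfloor>l a + t\<rfloor>) ` I) (cell (\<lambda>a. \<lfloor>l a + t\<rfloor>)) (x j)))\<^sup>2
        \<le> real (card J) * (B * D + B\<^sup>2 / real M)"
proof -
  define w where "w j a b = (norm (p a * x j * p b))\<^sup>2" for j a b
  define loss where "loss t j = (\<Sum>a\<in>I. \<Sum>b\<in>I. if \<lfloor>l a + t\<rfloor> = \<lfloor>l b + t\<rfloor> then 0 else w j a b)" for t :: real and j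
  define R where "R = real (card J) * (B * D + B\<^sup>2 / real M)"
  have loss_nonneg: "0 \<le> loss t j" for t j
    unfolding loss_def w_def by (intro sum_nonneg) auto
  \<comment> \<open>A block is lost only under shifts that separate its labels, and these are at
    most \<open>M * \<bar>l a - l b\<bar> + 1\<close> of the \<open>M\<close> shifts.\<close>
  have avg: "(\<Sum>s<M. loss (real s / real M) j) \<le> real M * (B * D + B\<^sup>2 / real M)" if j: "j \<in> J" for j
  proof -
    have "(\<Sum>s<M. loss (real s / real M) j)
        = (\<Sum>a\<in>I. \<Sum>b\<in>I. \<Sum>s<M. if \<lfloor>l a + real s / real M\<rfloor> = \<lfloor>l b + real s / real M\<rfloor> then 0 else w j a b)"
      unfolding loss_def by (subst sum.swap, rule sum.cong[OF refl], rule sum.swap)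
    also have "\<dots> = (\<Sum>a\<in>I. \<Sum>b\<in>I. w j a b * (\<Sum>s<M. if \<lfloor>l a + real s / real M\<rfloor> = \<lfloor>l b + real s / real M\<rfloor> then 0 else 1))"
      by (intro sum.cong refl) (auto simp add: sum_distrib_left intro!: sum.cong)
    also have "\<dots> \<le> (\<Sum>a\<in>I. \<Sum>b\<in>I. w j a b * (real M * \<bar>l a - l b\<bar> + 1))"
      by (intro sum_mono mult_left_mono card_floor_separated_le M) (simp add: w_def)
    also have "\<dots> = real M * (\<Sum>a\<in>I. \<Sum>b\<in>I. \<bar>l a - l b\<bar> * w j a b) + (\<Sum>a\<in>I. \<Sum>b\<in>I. w j a b)"
      by (simp add: algebra_simps sum.distrib sum_distrib_left)
    also have "\<dots> \<le> real M * (B * D) + B\<^sup>2"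
    proof (intro add_mono mult_left_mono)
      show "(\<Sum>a\<in>I. \<Sum>b\<in>I. \<bar>l a - l b\<bar> * w j a b) \<le> B * D"
        unfolding w_def by (rule sum_weighted_abs_le) (use assms j in auto)
      show "(\<Sum>a\<in>I. \<Sum>b\<in>I. w j a b) \<le> B\<^sup>2"
        unfolding w_def norm_parseval[OF corner[OF j], symmetric] using B[OF j] by (intro power_mono) auto
    qed simp
    also have "\<dots> = real M * (B * D + B\<^sup>2 / real M)" using M by (simp add: field_simps)
    finally show ?thesis .
  qed
  \<comment> \<open>Averaging the total loss over \<open>J\<close> yields a single shift that serves
    all elements at once; the price is the factor \<open>card J\<close>.\<close>
  have "\<exists>s<M. (\<Sum>j\<in>J. loss (real s / real M) j) \<le> R"
  proof (rule ccontr)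
    assume "\<not> ?thesis"
    then have "\<And>s. s < M \<Longrightarrow> R < (\<Sum>j\<in>J. loss (real s / real M) j)" by force
    then have "(\<Sum>s<M. R) < (\<Sum>s<M. \<Sum>j\<in>J. loss (real s / real M) j)"
      using M by (intro sum_strict_mono) auto
    also have "\<dots> = (\<Sum>j\<in>J. \<Sum>s<M. loss (real s / real M) j)" by (rule sum.swap)
    also have "\<dots> \<le> (\<Sum>j\<in>J. real M * (B * D + B\<^sup>2 / real M))" by (intro sum_mono avg)
    also have "\<dots> = (\<Sum>s<M. R)" by (simp add: R_def mult_ac)
    finally show False by simp
  qed
  then obtain s where s: "s < M" "(\<Sum>j\<in>J. loss (real s / real M) j) \<le> R" by blast
  show ?thesis
  proof
    show "0 \<le> real s / real M" "real s / real M < 1" using s(1) by auto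
    fix j assume j: "j \<in> J"
    have "(norm (x j - proj_family.pinch ((\<lambda>a. \<lfloor>l a + real s / real M\<rfloor>) ` I) (cell (\<lambda>a. \<lfloor>l a + real s / real M\<rfloor>)) (x j)))\<^sup>2
        = loss (real s / real M) j"
      unfolding loss_def w_def by (rule norm_diff_pinch_cell) (use corner j in auto)
    also have "\<dots> \<le> (\<Sum>j\<in>J. loss (real s / real M) j)"
      by (rule member_le_sum[OF j _ J]) (rule loss_nonneg)
    also have "\<dots> \<le> R" by (rule s(2))
    finally show "(norm (x j - proj_family.pinch ((\<lambda>a. \<lfloor>l a + real s / real M\<rfloor>) ` I) (cell (\<lambda>a. \<lfloor>l a + real s / real M\<rfloor>)) (x j)))\<^sup>2
        \<le> real (card J) * (B * D + B\<^sup>2 / real M)" unfolding R_def .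
  qed
qed

end

subsection \<open>The algebra of finitely supported matrices\<close>

text \<open>All dimensions live in one type, so that the ring and inner product classes apply. The algebra has
  no unit; \<open>n \<times> n\<close> matrices form the corner with unit \<open>idm n\<close>.\<close>

typedef fsmat = "{f :: nat \<Rightarrow> nat \<Rightarrow> complex. \<exists>N. \<forall>i j. N \<le> i \<or> N \<le> j \<longrightarrow> f i j = 0}"
  morphisms entry Abs_fsmat
  by (rule exI[of _ "\<lambda>_ _. 0"]) simp

setup_lifting type_definition_fsmat

lemma fsmat_eqI: "(\<And>i j. entry x i j = entry y i j) \<Longrightarrow> x = y"
  by (simp add: entry_inject[symmetric] fun_eq_iff)

definition supp_below :: "nat \<Rightarrow> fsmat \<Rightarrow> bool" where
  "supp_below N x \<longleftrightarrow> (\<forall>i j. N \<le> i \<or> N \<le> j \<longrightarrow> entry x i j = 0)"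

lemma supp_below_exists: "\<exists>N. supp_below N x"
  using entry[of x] by (auto simp: supp_below_def)

lemma supp_below_mono: "supp_below N x \<Longrightarrow> N \<le> M \<Longrightarrow> supp_below M x"
  by (auto simp: supp_below_def)

lemma supp_below_exists3: "\<exists>N. supp_below N x \<and> supp_below N y \<and> supp_below N z"
proof -
  obtain a b c where "supp_below a x" "supp_below b y" "supp_below c z"
    using supp_below_exists by metis
  then have "supp_below (max a (max b c)) x \<and> supp_below (max a (max b c)) y \<and> supp_below (max a (max b c)) z"
    by (auto elim: supp_below_mono)
  then show ?thesis by blast
qed

instantiation fsmat :: ring
begin

lift_definition zero_fsmat :: fsmat is "\<lambda>_ _. 0" by simp

lift_definition plus_fsmat :: "fsmat \<Rightarrow> fsmat \<Rightarrow> fsmat" is "\<lambda>f g i j. f i j + g i j"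
proof -
  fix f g :: "nat \<Rightarrow> nat \<Rightarrow> complex"
  assume "\<exists>N. \<forall>i j. N \<le> i \<or> N \<le> j \<longrightarrow> f i j = 0" "\<exists>N. \<forall>i j. N \<le> i \<or> N \<le> j \<longrightarrow> g i j = 0"
  then obtain N M where "\<forall>i j. N \<le> i \<or> N \<le> j \<longrightarrow> f i j = 0" "\<forall>i j. M \<le> i \<or> M \<le> j \<longrightarrow> g i j = 0"
    by auto
  then show "\<exists>N. \<forall>i j. N \<le> i \<or> N \<le> j \<longrightarrow> f i j + g i j = 0"
    by (intro exI[of _ "max N M"]) auto
qed

lift_definition uminus_fsmat :: "fsmat \<Rightarrow> fsmat" is "\<lambda>f i j. - f i j" by simp

definition minus_fsmat :: "fsmat \<Rightarrow> fsmat \<Rightarrow> fsmat" where "minus_fsmat x y = x + (- y)"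

text \<open>Summing over the support of a row, which is finite, avoids choosing a bound for the
  supports. The entry lemmas below replace it by any range that contains the support.\<close>

lift_definition times_fsmat :: "fsmat \<Rightarrow> fsmat \<Rightarrow> fsmat"
  is "\<lambda>f g i k. \<Sum>j\<in>{j. f i j \<noteq> 0}. f i j * g j k"
proof -
  fix f g :: "nat \<Rightarrow> nat \<Rightarrow> complex"
  assume "\<exists>N. \<forall>i j. N \<le> i \<or> N \<le> j \<longrightarrow> f i j = 0" "\<exists>N. \<forall>i j. N \<le> i \<or> N \<le> j \<longrightarrow> g i j = 0"
  then obtain N M where "\<forall>i j. N \<le> i \<or> N \<le> j \<longrightarrow> f i j = 0" "\<forall>i j. M \<le> i \<or> M \<le> j \<longrightarrow> g i j = 0"
    by auto
  then show "\<exists>N. \<forall>i k. N \<le> i \<or> N \<le> k \<longrightarrow> (\<Sum>j\<in>{j. f i j \<noteq> 0}. f i j * g j k) = 0"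
    by (intro exI[of _ "max N M"]) (auto intro!: sum.neutral)
qed

lemma entry_zero [simp]: "entry 0 i j = 0"
  by (simp add: zero_fsmat.rep_eq)

lemma entry_add [simp]: "entry (x + y) i j = entry x i j + entry y i j"
  by (simp add: plus_fsmat.rep_eq)

lemma entry_uminus [simp]: "entry (- x) i j = - entry x i j"
  by (simp add: uminus_fsmat.rep_eq)

lemma entry_diff [simp]: "entry (x - y) i j = entry x i j - entry y i j"
  by (simp add: minus_fsmat_def)

lemma entry_mult_left: "supp_below N x \<Longrightarrow> entry (x * y) i k = (\<Sum>j<N. entry x i j * entry y j k)"
  unfolding times_fsmat.rep_eq
  by (rule sum.mono_neutral_left) (auto simp: supp_below_def not_le[symmetric])

lemma entry_mult_right:
  assumes "supp_below N y"
  shows "entry (x * y) i k = (\<Sum>j<N. entry x i j * entry y j k)"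
proof -
  obtain M where M: "supp_below M x" using supp_below_exists by blast
  have "entry (x * y) i k = (\<Sum>j<max M N. entry x i j * entry y j k)"
    by (rule entry_mult_left) (rule supp_below_mono[OF M], simp)
  also have "\<dots> = (\<Sum>j<N. entry x i j * entry y j k)"
    by (rule sum.mono_neutral_right) (use assms in \<open>auto simp: supp_below_def\<close>)
  finally show ?thesis .
qed

instance
proof
  fix x y z :: fsmat
  show "x + y + z = x + (y + z)" "x + y = y + x" "0 + x = x" "- x + x = 0" "x - y = x + - y"
    by (auto intro!: fsmat_eqI simp: add_ac)
  obtain N where N: "supp_below N x" "supp_below N y" "supp_below N z"
    using supp_below_exists3 by blast
  show "x * y * z = x * (y * z)"
  proof (rule fsmat_eqI)
    fix i k
    have "entry (x * y * z) i k = (\<Sum>j<N. \<Sum>l<N. entry x i l * entry y l j * entry z j k)"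
      by (simp add: entry_mult_right[OF N(3)] entry_mult_left[OF N(1)] sum_distrib_right)
    also have "\<dots> = (\<Sum>l<N. \<Sum>j<N. entry x i l * entry y l j * entry z j k)"
      by (rule sum.swap)
    also have "\<dots> = entry (x * (y * z)) i k"
      by (simp add: entry_mult_left[OF N(1)] entry_mult_right[OF N(3)] sum_distrib_left mult.assoc)
    finally show "entry (x * y * z) i k = entry (x * (y * z)) i k" .
  qed
  show "(x + y) * z = x * z + y * z" "z * (x + y) = z * x + z * y"
    by (auto intro!: fsmat_eqI simp: entry_mult_right[OF N(3)] entry_mult_left[OF N(3)] algebra_simps sum.distrib)
qed

end

text \<open>Complex scalars are a separate operation, since the type classes in use provide only
  real ones.\<close>

lift_definition cscale :: "complex \<Rightarrow> fsmat \<Rightarrow> fsmat" is "\<lambda>c f i j. c * f i j" by auto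

lift_definition fsmat_adj :: "fsmat \<Rightarrow> fsmat" is "\<lambda>f i j. cnj (f j i)" by auto

lemma entry_cscale [simp]: "entry (cscale c x) i j = c * entry x i j"
  by (simp add: cscale.rep_eq)

lemma entry_fsmat_adj [simp]: "entry (fsmat_adj x) i j = cnj (entry x j i)"
  by (simp add: fsmat_adj.rep_eq)

lemma cscale_mult_left [simp]: "cscale c x * y = cscale c (x * y)"
proof -
  obtain N where "supp_below N y" using supp_below_exists by blast
  then show ?thesis by (auto intro!: fsmat_eqI simp: entry_mult_right sum_distrib_left mult.assoc)
qed

lemma cscale_mult_right [simp]: "x * cscale c y = cscale c (x * y)"
proof -
  obtain N where "supp_below N x" using supp_below_exists by blast
  then show ?thesis by (auto intro!: fsmat_eqI simp: entry_mult_left sum_distrib_left mult_ac)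
qed

instantiation fsmat :: real_algebra
begin

definition scaleR_fsmat :: "real \<Rightarrow> fsmat \<Rightarrow> fsmat" where
  "scaleR_fsmat r x = cscale (of_real r) x"

lemma entry_scaleR [simp]: "entry (r *\<^sub>R x) i j = of_real r * entry x i j"
  by (simp add: scaleR_fsmat_def)

instance
proof
  fix a b :: real and x y :: fsmat
  show "a *\<^sub>R (x + y) = a *\<^sub>R x + a *\<^sub>R y" "(a + b) *\<^sub>R x = a *\<^sub>R x + b *\<^sub>R x"
    "a *\<^sub>R b *\<^sub>R x = (a * b) *\<^sub>R x" "1 *\<^sub>R x = x"
    by (auto intro!: fsmat_eqI simp: algebra_simps)
  show "a *\<^sub>R x * y = a *\<^sub>R (x * y)" "x * a *\<^sub>R y = a *\<^sub>R (x * y)"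
    by (simp_all add: scaleR_fsmat_def)
qed

end

instantiation fsmat :: real_inner
begin

text \<open>The real part of the trace of \<open>x * adj y\<close>; the induced norm is the
  Hilbert-Schmidt norm without normalisation.\<close>

definition inner_fsmat :: "fsmat \<Rightarrow> fsmat \<Rightarrow> real" where
  "inner_fsmat x y = (\<Sum>(i, j)\<in>{(i, j). entry x i j \<noteq> 0}. Re (entry x i j * cnj (entry y i j)))"

definition norm_fsmat :: "fsmat \<Rightarrow> real" where
  "norm_fsmat x = sqrt (inner x x)"

definition dist_fsmat :: "fsmat \<Rightarrow> fsmat \<Rightarrow> real" where
  "dist_fsmat x y = norm (x - y)"

definition sgn_fsmat :: "fsmat \<Rightarrow> fsmat" where
  "sgn_fsmat x = inverse (norm x) *\<^sub>R x"

definition uniformity_fsmat :: "(fsmat \<times> fsmat) filter" where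
  "uniformity_fsmat = (INF e\<in>{0<..}. principal {(x, y). dist x y < e})"

definition open_fsmat :: "fsmat set \<Rightarrow> bool" where
  "open_fsmat S = (\<forall>x\<in>S. \<forall>\<^sub>F (x', y) in uniformity. x' = x \<longrightarrow> y \<in> S)"

lemma inner_fsmat_eq:
  "supp_below N x \<Longrightarrow> inner x y = (\<Sum>i<N. \<Sum>j<N. Re (entry x i j * cnj (entry y i j)))"
  unfolding inner_fsmat_def sum.cartesian_product
  by (rule sum.mono_neutral_left) (auto simp: supp_below_def not_le[symmetric])

lemma inner_fsmat_self:
  "supp_below N x \<Longrightarrow> inner x x = (\<Sum>i<N. \<Sum>j<N. (cmod (entry x i j))\<^sup>2)"
  unfolding inner_fsmat_eq
  by (intro sum.cong refl) (simp add: complex_mult_cnj cmod_power2 del: times_complex.sel)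

instance
proof
  fix x y z :: fsmat and r :: real
  obtain N where N: "supp_below N x" "supp_below N y" "supp_below N z"
    using supp_below_exists3 by blast
  have Nadd: "supp_below N (x + y)" and Nsc: "supp_below N (r *\<^sub>R x)"
    using N by (auto simp: supp_below_def)
  show "inner x y = inner y x"
    by (simp add: inner_fsmat_eq[OF N(1)] inner_fsmat_eq[OF N(2)] mult_ac)
  show "inner (x + y) z = inner x z + inner y z"
    by (simp add: inner_fsmat_eq[OF N(1)] inner_fsmat_eq[OF N(2)] inner_fsmat_eq[OF Nadd] algebra_simps sum.distrib)
  show "inner (r *\<^sub>R x) y = r * inner x y"
    by (simp add: inner_fsmat_eq[OF N(1)] inner_fsmat_eq[OF Nsc] algebra_simps sum_distrib_left)
  show nn: "0 \<le> inner x x"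
    unfolding inner_fsmat_self[OF N(1)] by (intro sum_nonneg) simp
  show "inner x x = 0 \<longleftrightarrow> x = 0"
  proof
    assume "inner x x = 0"
    then have "\<forall>i<N. \<forall>j<N. entry x i j = 0"
      unfolding inner_fsmat_self[OF N(1)] by (simp add: sum_nonneg_eq_0_iff sum_nonneg)
    then show "x = 0"
      using N(1) by (intro fsmat_eqI) (metis entry_zero not_le supp_below_def)
  qed (simp add: inner_fsmat_def)
  show "norm x = sqrt (inner x x)" by (rule norm_fsmat_def)
  show "dist x y = norm (x - y)" by (rule dist_fsmat_def)
  show "sgn x = x /\<^sub>R norm x" by (rule sgn_fsmat_def)
  show "uniformity = (INF e\<in>{0<..}. principal {(x::fsmat, y). dist x y < e})" by (rule uniformity_fsmat_def)
  show "open S = (\<forall>x\<in>S. \<forall>\<^sub>F (x', y) in uniformity. x' = x \<longrightarrow> y \<in> S)" for S :: "fsmat set"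
    by (rule open_fsmat_def)
qed

end

instantiation fsmat :: hs_algebra
begin

definition adj_fsmat :: "fsmat \<Rightarrow> fsmat" where
  "adj_fsmat x = fsmat_adj x"

lemma entry_adj [simp]: "entry (adj x) i j = cnj (entry x j i)"
  by (simp add: adj_fsmat_def)

instance
proof
  fix a x y :: fsmat and r :: real
  show "adj (adj x) = x" "adj (x + y) = adj x + adj y" "adj (r *\<^sub>R x) = r *\<^sub>R adj x"
    by (auto intro!: fsmat_eqI)
  obtain N where N: "supp_below N a" "supp_below N x" "supp_below N y"
    using supp_below_exists3 by blast
  have Nadj: "supp_below N (adj a)" "supp_below N (adj x)" "supp_below N (adj y)"
    using N by (auto simp: supp_below_def)
  show "adj (x * y) = adj y * adj x"
    by (auto intro!: fsmat_eqI simp: entry_mult_left[OF N(2)] entry_mult_left[OF Nadj(3)] mult_ac)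
  show "inner (adj x) (adj y) = inner x y"
    unfolding inner_fsmat_eq[OF N(2)] inner_fsmat_eq[OF Nadj(2)]
    by (subst sum.swap) (simp add: mult_ac)
  have Nax: "supp_below N (a * x)"
    using N by (auto simp: supp_below_def entry_mult_left[OF N(1)] intro!: sum.neutral)
  have "inner (a * x) y = (\<Sum>i<N. \<Sum>k<N. \<Sum>j<N. Re (entry a i j * entry x j k * cnj (entry y i k)))"
    by (simp add: inner_fsmat_eq[OF Nax] entry_mult_left[OF N(1)] sum_distrib_right del: times_complex.sel)
  also have "\<dots> = (\<Sum>k<N. \<Sum>i<N. \<Sum>j<N. Re (entry a i j * entry x j k * cnj (entry y i k)))"
    by (rule sum.swap)
  also have "\<dots> = (\<Sum>k<N. \<Sum>j<N. \<Sum>i<N. Re (entry a i j * entry x j k * cnj (entry y i k)))"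
    by (rule sum.cong[OF refl], rule sum.swap)
  also have "\<dots> = (\<Sum>j<N. \<Sum>k<N. \<Sum>i<N. Re (entry a i j * entry x j k * cnj (entry y i k)))"
    by (rule sum.swap)
  also have "\<dots> = inner x (adj a * y)"
    by (simp add: inner_fsmat_eq[OF N(2)] entry_mult_left[OF Nadj(1)] sum_distrib_left mult_ac del: times_complex.sel)
  finally show "inner (a * x) y = inner x (adj a * y)" .
qed

end

lemma cscale_simps [simp]:
  "cscale 0 x = 0" "cscale 1 x = x" "cscale c 0 = 0" "cscale c (cscale d x) = cscale (c * d) x"
  "adj (cscale c x) = cscale (cnj c) (adj x)"
  by (auto intro!: fsmat_eqI)

lemma cscale_add_right: "cscale c (x + y) = cscale c x + cscale c y"
  by (auto intro!: fsmat_eqI simp: algebra_simps)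

lemma cscale_diff_right: "cscale c (x - y) = cscale c x - cscale c y"
  by (auto intro!: fsmat_eqI simp: algebra_simps)

lemma cscale_diff_left: "cscale (c - d) x = cscale c x - cscale d x"
  by (auto intro!: fsmat_eqI simp: algebra_simps)

lemma cscale_of_real: "cscale (of_real r) x = r *\<^sub>R x"
  by (simp add: scaleR_fsmat_def)

lemma cscale_eq_0_iff: "cscale c x = 0 \<longleftrightarrow> c = 0 \<or> x = 0"
proof
  assume "cscale c x = 0"
  then have "entry (cscale c x) i j = 0" for i j by simp
  then have "c = 0 \<or> (\<forall>i j. entry x i j = 0)" by auto
  then show "c = 0 \<or> x = 0" by (auto intro: fsmat_eqI)
qed auto

lemma norm_fsmat_sq:
  assumes "supp_below N x"
  shows "(norm x)\<^sup>2 = (\<Sum>i<N. \<Sum>j<N. (cmod (entry x i j))\<^sup>2)"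
  using inner_fsmat_self[OF assms] by (simp add: dot_square_norm)

lemma norm_cscale: "norm (cscale c x) = cmod c * norm x"
proof -
  obtain N where N: "supp_below N x" using supp_below_exists by blast
  then have N': "supp_below N (cscale c x)" by (auto simp: supp_below_def)
  have "(norm (cscale c x))\<^sup>2 = (cmod c * norm x)\<^sup>2"
    by (simp add: norm_fsmat_sq[OF N] norm_fsmat_sq[OF N'] norm_mult power_mult_distrib sum_distrib_left)
  then show ?thesis by (simp add: power2_eq_iff_nonneg)
qed

section \<open>Embedding matrices of a fixed dimension\<close>

lift_definition idm :: "nat \<Rightarrow> fsmat" is "\<lambda>n i j. if i = j \<and> i < n then 1 else 0"
  by (metis not_le)

text \<open>The diagonal matrix unit at \<open>k\<close>. An element \<open>v\<close> with
  \<open>v * unit_mat k = v\<close> is concentrated in column \<open>k\<close> and serves as a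
  vector.\<close>

lift_definition unit_mat :: "nat \<Rightarrow> fsmat" is "\<lambda>k i j. if i = k \<and> j = k then 1 else 0"
  by (metis Suc_n_not_le_n)

lift_definition of_mat :: "complex mat \<Rightarrow> fsmat"
  is "\<lambda>A i j. if i < dim_row A \<and> j < dim_col A then A $$ (i, j) else 0"
  by (rule_tac x = "max (dim_row mat) (dim_col mat)" in exI) auto

lemma entry_idm [simp]: "entry (idm n) i j = (if i = j \<and> i < n then 1 else 0)"
  by (simp add: idm.rep_eq)

lemma entry_unit_mat [simp]: "entry (unit_mat k) i j = (if i = k \<and> j = k then 1 else 0)"
  by (simp add: unit_mat.rep_eq)

lemma entry_of_mat [simp]:
  "entry (of_mat A) i j = (if i < dim_row A \<and> j < dim_col A then A $$ (i, j) else 0)"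
  by (simp add: of_mat.rep_eq)

lemma supp_below_idm: "supp_below n (idm n)"
  by (simp add: supp_below_def)

lemma supp_below_unit_mat: "supp_below (Suc k) (unit_mat k)"
  by (simp add: supp_below_def)

lemma entry_idm_mult: "entry (idm n * x) i j = (if i < n then entry x i j else 0)"
  by (simp add: entry_mult_left[OF supp_below_idm] if_distrib[of "\<lambda>z. z * _"] cong: if_cong)

lemma entry_mult_idm: "entry (x * idm n) i j = (if j < n then entry x i j else 0)"
  by (simp add: entry_mult_right[OF supp_below_idm] if_distrib[of "\<lambda>z. _ * z"] cong: if_cong)

lemma entry_mult_unit_mat: "entry (x * unit_mat k) i j = (if j = k then entry x i k else 0)"
  by (simp add: entry_mult_right[OF supp_below_unit_mat] if_distrib[of "\<lambda>z. _ * z"] cong: if_cong)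

text \<open>Turns the condition on entries into the algebraic corner conditions that
  \<open>proj_family\<close> works with.\<close>

lemma supp_below_iff_idm: "supp_below n x \<longleftrightarrow> idm n * x = x \<and> x * idm n = x"
proof
  assume "supp_below n x"
  then show "idm n * x = x \<and> x * idm n = x"
    by (auto intro!: fsmat_eqI simp: entry_idm_mult entry_mult_idm supp_below_def)
next
  assume *: "idm n * x = x \<and> x * idm n = x"
  have "entry x i j = 0" if "n \<le> i \<or> n \<le> j" for i j
    using that entry_idm_mult[of n x i j] entry_mult_idm[of x n i j] * by auto
  then show "supp_below n x" by (simp add: supp_below_def)
qed

lemma adj_idm [simp]: "adj (idm n) = idm n"
  by (auto intro!: fsmat_eqI)

lemma idm_idem [simp]: "idm n * idm n = idm n"
  using supp_below_idm supp_below_iff_idm by blast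

lemma norm_idm_sq: "(norm (idm n))\<^sup>2 = real n"
proof -
  have "(norm (idm n))\<^sup>2 = (\<Sum>i<n. \<Sum>j<n. if i = j then 1 else 0)"
    unfolding norm_fsmat_sq[OF supp_below_idm] by (intro sum.cong refl) auto
  then show ?thesis by simp
qed

lemma supp_below_of_mat: "A \<in> carrier_mat n n \<Longrightarrow> supp_below n (of_mat A)"
  by (auto simp: supp_below_def)

lemma of_mat_mult:
  assumes "A \<in> carrier_mat n n" "B \<in> carrier_mat n n"
  shows "of_mat (A * B) = of_mat A * of_mat B"
  using assms
  by (auto intro!: fsmat_eqI sum.cong simp: entry_mult_left[OF supp_below_of_mat[OF assms(1)]]
      scalar_prod_def lessThan_atLeast0 intro: sum.neutral)

lemma of_mat_one: "of_mat (1\<^sub>m n) = idm n"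
  by (auto intro!: fsmat_eqI)

lemma of_mat_diff:
  "A \<in> carrier_mat n n \<Longrightarrow> B \<in> carrier_mat n n \<Longrightarrow> of_mat (A - B) = of_mat A - of_mat B"
  by (auto intro!: fsmat_eqI)

lemma mat_adjoint_index:
  "i < dim_col A \<Longrightarrow> j < dim_row A \<Longrightarrow> mat_adjoint A $$ (i, j) = cnj (A $$ (j, i))"
  by (simp add: mat_adjoint_def mat_of_rows_def)

lemma mat_adjoint_dim [simp]: "dim_row (mat_adjoint A) = dim_col A" "dim_col (mat_adjoint A) = dim_row A"
  by (simp_all add: mat_adjoint_def)

lemma of_mat_adjoint: "of_mat (mat_adjoint A) = adj (of_mat A)"
  by (auto intro!: fsmat_eqI simp: mat_adjoint_index)

lemma of_mat_inject:
  "A \<in> carrier_mat n n \<Longrightarrow> B \<in> carrier_mat n n \<Longrightarrow> of_mat A = of_mat B \<longleftrightarrow> A = B"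
proof
  assume AB: "A \<in> carrier_mat n n" "B \<in> carrier_mat n n" and "of_mat A = of_mat B"
  then have "entry (of_mat A) i j = entry (of_mat B) i j" for i j by simp
  then show "A = B" using AB by (intro eq_matI) (auto split: if_splits, metis)
qed simp

lemma of_mat_surj:
  assumes "supp_below n x"
  obtains A where "A \<in> carrier_mat n n" "of_mat A = x"
proof
  show "mat n n (\<lambda>(i, j). entry x i j) \<in> carrier_mat n n" by simp
  show "of_mat (mat n n (\<lambda>(i, j). entry x i j)) = x"
    using assms by (auto intro!: fsmat_eqI simp: supp_below_def)
qed

lemma tr_norm_eq: "A \<in> carrier_mat n n \<Longrightarrow> tr_norm A = norm (of_mat A) / sqrt (real n)"
proof -
  assume A: "A \<in> carrier_mat n n"
  have "norm (of_mat A) = sqrt (\<Sum>i<n. \<Sum>j<n. (cmod (A $$ (i, j)))\<^sup>2)"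
    using norm_fsmat_sq[OF supp_below_of_mat[OF A]] A by (intro real_sqrt_unique[symmetric]) auto
  then show ?thesis using A by (simp add: tr_norm_def real_sqrt_divide)
qed

subsection \<open>The spectral theorem for normal matrices\<close>

text \<open>Triangularise \<open>A P = P B\<close>. As \<open>e\<close> commutes with \<open>A\<close>, the first column of \<open>P\<close> that \<open>e\<close> does
  not annihilate is mapped by \<open>e\<close> to an eigenvector of \<open>A\<close>.\<close>

lemma exists_eigen_column:
  assumes A: "supp_below n A" and e: "idm n * e = e" "e * idm n = e" "e * A = A * e" "e * e = e" "e \<noteq> 0"
  obtains v c k where "v \<noteq> 0" "e * v = v" "A * v = cscale c v" "v * unit_mat k = v"
proof -
  obtain A' where A': "A' \<in> carrier_mat n n" "of_mat A' = A" using of_mat_surj[OF A] .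
  obtain as where "char_poly A' = (\<Prod>a\<leftarrow>as. [:- a, 1:])"
    using char_poly_factorized[OF A'(1)] by blast
  then obtain B where B: "B \<in> carrier_mat n n" "upper_triangular B" "similar_mat A' B"
    using schur_decomposition_exists[OF A'(1)] by blast
  then obtain P Q where "similar_mat_wit A' B P Q" by (auto simp: similar_mat_def)
  note PQ = similar_mat_witD2[OF A'(1) this]
  have "A' * P = P * B * (Q * P)"
    unfolding PQ(3) using PQ by (intro assoc_mult_mat[of _ n n _ n _ n]) auto
  then have AP: "A' * P = P * B" using PQ B(1) by simp
  define y where "y = e * of_mat P"
  have "A * of_mat P = of_mat P * of_mat B"
    using arg_cong[OF AP, of of_mat] of_mat_mult[OF A'(1) PQ(6)] of_mat_mult[OF PQ(6) B(1)] A'(2) by simp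
  then have yA: "A * y = y * of_mat B"
    unfolding y_def using e(3) by (metis mult.assoc)
  have "y * of_mat Q = e * of_mat (P * Q)"
    unfolding of_mat_mult[OF PQ(6,7)] by (simp add: y_def mult.assoc)
  \<comment> \<open>Since \<open>P\<close> is invertible, \<open>e\<close> can be recovered from
    \<open>y\<close>, so some column of \<open>y\<close> is nonzero.\<close>
  then have "y * of_mat Q = e" using PQ(1) e(2) by (simp add: of_mat_one)
  then have "y \<noteq> 0" using e(5) by auto
  then have ex: "\<exists>k i. entry y i k \<noteq> 0" by (metis entry_zero fsmat_eqI)
  define k where "k = (LEAST k. \<exists>i. entry y i k \<noteq> 0)"
  have k: "\<exists>i. entry y i k \<noteq> 0" unfolding k_def by (rule LeastI_ex[OF ex])
  have below: "entry y i j = 0" if "j < k" for i j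
    using not_less_Least[OF that[unfolded k_def]] by blast
  have "supp_below n y"
    unfolding supp_below_iff_idm y_def
    using supp_below_of_mat[OF PQ(6)] e by (simp add: supp_below_iff_idm mult.assoc) (simp add: mult.assoc[symmetric])
  then have kn: "k < n" using k by (auto simp: supp_below_def not_le[symmetric])
  show ?thesis
  proof
    show "y * unit_mat k \<noteq> 0"
      using k by (metis entry_mult_unit_mat entry_zero)
    show "e * (y * unit_mat k) = y * unit_mat k"
      by (simp add: y_def mult.assoc[symmetric] e(4))
    show "y * unit_mat k * unit_mat k = y * unit_mat k"
      by (auto intro!: fsmat_eqI simp: entry_mult_unit_mat)
    have "entry (y * of_mat B) i k = B $$ (k, k) * entry y i k" for i
    proof -
      have "entry (y * of_mat B) i k = (\<Sum>j<n. entry y i j * entry (of_mat B) j k)"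
        by (rule entry_mult_right[OF supp_below_of_mat[OF B(1)]])
      \<comment> \<open>Only the diagonal term survives: columns of \<open>y\<close> before
        \<open>k\<close> vanish by minimality of \<open>k\<close>, and entries of \<open>B\<close>
        below the diagonal vanish.\<close>
      also have "\<dots> = (\<Sum>j<n. if j = k then B $$ (k, k) * entry y i k else 0)"
      proof (rule sum.cong[OF refl])
        fix j assume "j \<in> {..<n}"
        then show "entry y i j * entry (of_mat B) j k = (if j = k then B $$ (k, k) * entry y i k else 0)"
          using B kn below[of j i] upper_triangularD[OF B(2), of k j] by (cases j k rule: linorder_cases) auto
      qed
      finally show ?thesis using kn by simp
    qed
    then have "y * of_mat B * unit_mat k = cscale (B $$ (k, k)) (y * unit_mat k)"
      by (intro fsmat_eqI) (simp add: entry_mult_unit_mat)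
    then show "A * (y * unit_mat k) = cscale (B $$ (k, k)) (y * unit_mat k)"
      by (simp add: mult.assoc[symmetric] yA)
  qed
qed

text \<open>As \<open>v\<close> is a single column, \<open>adj v * v\<close> is the scalar product
  of that column with itself, placed at \<open>(k, k)\<close>. Hence \<open>v * adj v\<close> is a
  multiple of a projection.\<close>

lemma adj_mult_self_column:
  assumes "v * unit_mat k = v"
  shows "adj v * v = (norm v)\<^sup>2 *\<^sub>R unit_mat k"
proof (rule fsmat_eqI)
  fix i j
  obtain N where N: "supp_below N v" using supp_below_exists by blast
  have v: "entry v l m = (if m = k then entry v l k else 0)" for l m
    using entry_mult_unit_mat[of v k l m] assms by simp
  have N': "supp_below N (adj v)" using N by (auto simp: supp_below_def)
  have "(norm v)\<^sup>2 = (\<Sum>l<N. (cmod (entry v l k))\<^sup>2)"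
  proof (cases "k < N")
    case True
    have "(norm v)\<^sup>2 = (\<Sum>l<N. \<Sum>m<N. if m = k then (cmod (entry v l k))\<^sup>2 else 0)"
      unfolding norm_fsmat_sq[OF N] by (intro sum.cong refl) (subst v, simp)
    then show ?thesis using True by simp
  next
    case False
    have "(norm v)\<^sup>2 = (\<Sum>l<N. \<Sum>m<N. 0)"
      unfolding norm_fsmat_sq[OF N] using False by (subst v) (auto intro!: sum.cong)
    moreover have "entry v l k = 0" for l using N False by (auto simp: supp_below_def)
    ultimately show ?thesis by simp
  qed
  then have nv: "complex_of_real ((norm v)\<^sup>2) = (\<Sum>l<N. cnj (entry v l k) * entry v l k)"
    by (simp add: complex_norm_square mult.commute flip: of_real_power)
  show "entry (adj v * v) i j = entry ((norm v)\<^sup>2 *\<^sub>R unit_mat k) i j"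
  proof (cases "i = k \<and> j = k")
    case True
    then show ?thesis using nv by (simp add: entry_mult_left[OF N'])
  next
    case False
    have "entry (adj v * v) i j = (\<Sum>l<N. cnj (entry v l i) * entry v l j)"
      by (simp add: entry_mult_left[OF N'])
    also have "\<dots> = 0"
      using False by (intro sum.neutral ballI) (subst (1 2) v, auto)
    finally show ?thesis using False by auto
  qed
qed

text \<open>For the normal element \<open>B = A - c\<close> the norms of \<open>adj B * q\<close>
  and \<open>B * q\<close> agree, and the latter is zero.\<close>

lemma normal_eigen_adj:
  assumes "adj A * A = A * adj A" "supp_below n A" "idm n * q = q" "A * q = cscale c q"
  shows "adj A * q = cscale (cnj c) q"
proof -
  define B where "B = A - cscale c (idm n)"
  have A: "idm n * A = A" "A * idm n = A" using assms(2) by (auto simp: supp_below_iff_idm)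
  have A': "idm n * adj A = adj A" "adj A * idm n = adj A"
    using arg_cong[OF A(2), of adj] arg_cong[OF A(1), of adj] by simp_all
  have normal: "adj B * B = B * adj B"
    using assms(1) A A' by (simp add: B_def algebra_simps cscale_diff_right)
  have "B * q = 0" using assms(3,4) by (simp add: B_def algebra_simps)
  have "(norm (adj B * q))\<^sup>2 = inner q (B * adj B * q)"
    by (simp add: power2_norm_eq_inner inner_mult_adj_left mult.assoc)
  also have "\<dots> = inner q (adj B * (B * q))" by (simp add: normal[symmetric] mult.assoc)
  also have "\<dots> = 0" using \<open>B * q = 0\<close> by simp
  finally have "adj B * q = 0" by simp
  then show ?thesis using assms(3) by (simp add: B_def algebra_simps)
qed

text \<open>The projection onto the line of an eigenvector \<open>v\<close> below \<open>e\<close>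
  is \<open>v * adj v\<close> divided by the squared norm of \<open>v\<close>. The value
  \<open>norm q = 1\<close> records that its rank is one.\<close>

lemma exists_eigen_projection:
  assumes A: "supp_below n A" "adj A * A = A * adj A"
    and e: "idm n * e = e" "e * A = A * e" "e * e = e" "adj e = e" "e \<noteq> 0"
  obtains q c where "adj q = q" "q * q = q" "e * q = q" "q * e = q" "norm q = 1"
    "A * q = cscale c q" "q * A = cscale c q"
proof -
  have e': "e * idm n = e" using arg_cong[OF e(1), of adj] e(4) by simp
  obtain v c k where v: "v \<noteq> 0" "e * v = v" "A * v = cscale c v" "v * unit_mat k = v"
    using exists_eigen_column[OF A(1) e(1) e' e(2,3,5)] .
  define d where "d = (norm v)\<^sup>2"
  have d: "d > 0" using v(1) by (simp add: d_def)
  have vv: "adj v * v = d *\<^sub>R unit_mat k" unfolding d_def by (rule adj_mult_self_column[OF v(4)])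
  have "adj (unit_mat k) = unit_mat k" by (auto intro!: fsmat_eqI)
  then have uv: "unit_mat k * adj v = adj v" using arg_cong[OF v(4), of adj] by simp
  have vvv: "adj v * (v * adj v) = d *\<^sub>R adj v"
    by (simp add: mult.assoc[symmetric] vv) (simp add: uv)
  define q where "q = (1 / d) *\<^sub>R (v * adj v)"
  have q1: "adj q = q" by (simp add: q_def)
  have q2: "q * q = q" using d by (simp add: q_def mult.assoc vvv)
  have q3: "e * q = q" using v(2) by (simp add: q_def mult.assoc[symmetric])
  have q4: "q * e = q" using arg_cong[OF q3, of adj] q1 e(4) by simp
  have "(norm (v * adj v))\<^sup>2 = inner (adj v) (adj v * (v * adj v))"
    by (simp add: power2_norm_eq_inner inner_mult_adj_left)
  also have "\<dots> = d\<^sup>2" by (simp add: vvv dot_square_norm d_def power2_eq_square)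
  finally have "norm (v * adj v) = d" using d by (simp add: power2_eq_iff_nonneg)
  then have q5: "norm q = 1" using d by (simp add: q_def)
  have "A * (v * adj v) = cscale c (v * adj v)"
    using v(3) by (simp add: mult.assoc[symmetric])
  then have q6: "A * q = cscale c q"
    by (simp add: q_def flip: cscale_of_real)
  have "idm n * q = q" using q3 e(1) by (metis mult.assoc)
  then have "adj A * q = cscale (cnj c) q" by (rule normal_eigen_adj[OF A(2,1) _ q6])
  then have "adj (adj A * q) = adj (cscale (cnj c) q)" by (rule arg_cong)
  then have "q * A = cscale c q" using q1 by simp
  then show ?thesis using that q1 q2 q3 q4 q5 q6 by blast
qed

text \<open>Induction on the rank of \<open>e\<close>, which for a projection is
  \<open>(norm e)\<^sup>2\<close>. A rank one eigenprojection \<open>q\<close> is split off, and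
  \<open>e - q\<close> is again a projection commuting with \<open>A\<close>.\<close>

lemma spectral_normal_aux:
  assumes A: "supp_below n A" "adj A * A = A * adj A"
    and "idm n * e = e" "e * A = A * e" "e * e = e" "adj e = e" "(norm e)\<^sup>2 = real m"
  shows "\<exists>p c. proj_family e {..<m} p \<and> (\<forall>a<m. p a \<noteq> 0 \<and> A * p a = cscale (c a) (p a) \<and> p a * A = cscale (c a) (p a))"
  using assms(3-7)
proof (induction m arbitrary: e)
  case 0
  then have "e = 0" by simp
  then have "proj_family e {..<0::nat} (\<lambda>_. 0)" by unfold_locales auto
  then show ?case by auto
next
  case (Suc m)
  then have "e \<noteq> 0" by auto
  obtain q c where q: "adj q = q" "q * q = q" "e * q = q" "q * e = q" "norm q = 1"
    "A * q = cscale c q" "q * A = cscale c q"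
    using exists_eigen_projection[OF A Suc.prems(1-4) \<open>e \<noteq> 0\<close>] .
  have "q \<noteq> 0" using q(5) by auto
  have "inner e q = inner q (e * q)"
    using inner_mult_adj_left[of q e q] inner_mult_adj_left[of e q q] q Suc.prems(4) by (simp add: inner_commute)
  then have eq: "inner e q = 1" using q(3,5) by (simp add: dot_square_norm)
  have iq: "idm n * q = q" using q(3) Suc.prems(1) by (metis mult.assoc)
  \<comment> \<open>As \<open>q\<close> lies below \<open>e\<close>, the rank drops by exactly
    one.\<close>
  have "(norm (e - q))\<^sup>2 = (norm e)\<^sup>2 - 2 * inner e q + (norm q)\<^sup>2"
    by (simp add: power2_norm_eq_inner algebra_simps inner_commute)
  also have "\<dots> = real m" using Suc.prems(5) eq q(5) by simp
  finally have nm: "(norm (e - q))\<^sup>2 = real m" .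
  have "\<exists>p c. proj_family (e - q) {..<m} p \<and>
      (\<forall>a<m. p a \<noteq> 0 \<and> A * p a = cscale (c a) (p a) \<and> p a * A = cscale (c a) (p a))"
    by (rule Suc.IH[OF _ _ _ _ nm]) (use Suc.prems q iq in \<open>simp_all add: algebra_simps\<close>)
  then obtain p l where p: "proj_family (e - q) {..<m} p"
    "\<And>a. a < m \<Longrightarrow> p a \<noteq> 0 \<and> A * p a = cscale (l a) (p a) \<and> p a * A = cscale (l a) (p a)" by blast
  interpret P: proj_family "e - q" "{..<m}" p by (rule p(1))
  have qp: "q * p a = 0" if "a < m" for a
  proof -
    have "q * p a = q * ((e - q) * p a)" using P.e_p[of a] that by simp
    also have "\<dots> = (q * (e - q)) * p a" by (simp only: mult.assoc)
    also have "\<dots> = 0" using q by (simp add: algebra_simps)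
    finally show ?thesis .
  qed
  have pq: "p a * q = 0" if "a < m" for a
    using arg_cong[OF qp[OF that], of adj] P.adj_p[of a] that q(1) by simp
  have "proj_family e {..<Suc m} (p(m := q))"
  proof
    fix a b assume "a \<in> {..<Suc m}" "b \<in> {..<Suc m}"
    then have "a < m \<or> a = m" "b < m \<or> b = m" by auto
    then show "(p(m := q)) a * (p(m := q)) b = (if a = b then (p(m := q)) a else 0)"
      using q qp pq P.p_mult[of a b] by auto
    show "adj ((p(m := q)) a) = (p(m := q)) a"
      using \<open>a < m \<or> a = m\<close> q P.adj_p[of a] by auto
  next
    have "(\<Sum>a<m. (p(m := q)) a) = (\<Sum>a<m. p a)" by (rule sum.cong) auto
    then show "sum (p(m := q)) {..<Suc m} = e" using P.sum_p by simp
  qed auto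
  moreover have "\<forall>a<Suc m. (p(m := q)) a \<noteq> 0 \<and> A * (p(m := q)) a = cscale ((l(m := c)) a) ((p(m := q)) a)
      \<and> (p(m := q)) a * A = cscale ((l(m := c)) a) ((p(m := q)) a)"
    using p(2) q \<open>q \<noteq> 0\<close> by (auto simp: less_Suc_eq)
  ultimately show ?case by blast
qed

theorem spectral_normal:
  assumes "supp_below n A" "adj A * A = A * adj A"
  obtains p c where "proj_family (idm n) {..<n} p" "\<And>a. a < n \<Longrightarrow> p a \<noteq> 0"
    "\<And>a. a < n \<Longrightarrow> A * p a = cscale (c a) (p a)" "\<And>a. a < n \<Longrightarrow> p a * A = cscale (c a) (p a)"
proof -
  have "\<exists>p c. proj_family (idm n) {..<n} p \<and>
      (\<forall>a<n. p a \<noteq> 0 \<and> A * p a = cscale (c a) (p a) \<and> p a * A = cscale (c a) (p a))"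
    by (rule spectral_normal_aux[OF assms]) (use assms(1) in \<open>simp_all add: norm_idm_sq supp_below_iff_idm\<close>)
  then show ?thesis using that by blast
qed

text \<open>Taking adjoints in \<open>A * p a = cscale (c a) (p a)\<close> shows that each
  eigenvalue equals its conjugate, since \<open>p a\<close> is nonzero.\<close>

theorem spectral_hermitian:
  assumes "supp_below n A" "adj A = A"
  obtains p l where "proj_family (idm n) {..<n} p" "\<And>a. a < n \<Longrightarrow> p a \<noteq> 0"
    "A = proj_family.fc {..<n} p l"
proof -
  obtain p c where p: "proj_family (idm n) {..<n} p" "\<And>a. a < n \<Longrightarrow> p a \<noteq> 0"
    "\<And>a. a < n \<Longrightarrow> A * p a = cscale (c a) (p a)" "\<And>a. a < n \<Longrightarrow> p a * A = cscale (c a) (p a)"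
    using spectral_normal[of n A] assms by auto
  interpret P: proj_family "idm n" "{..<n}" p by (rule p(1))
  have real: "cscale (c a) (p a) = Re (c a) *\<^sub>R p a" if "a < n" for a
  proof -
    have "cscale (cnj (c a)) (p a) = adj (A * p a)" using p(3)[OF that] P.adj_p[of a] that by simp
    also have "\<dots> = cscale (c a) (p a)" using p(4)[OF that] P.adj_p[of a] that assms(2) by simp
    finally have "cscale (cnj (c a) - c a) (p a) = 0" by (simp add: cscale_diff_left)
    then have "cnj (c a) = c a" using p(2)[OF that] by (simp add: cscale_eq_0_iff)
    then have "c a = of_real (Re (c a))" by (simp add: complex_eq_iff)
    then show ?thesis by (metis cscale_of_real)
  qed
  have "A = A * idm n" using assms(1) by (simp add: supp_below_iff_idm)
  also have "\<dots> = P.fc (\<lambda>a. Re (c a))"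
    unfolding P.x_e_eq_sum P.fc_def by (rule sum.cong) (simp_all add: p(3) real)
  finally show ?thesis using that p(1,2) by blast
qed

context proj_family
begin

lemma fc_cell: "proj_family.fc (c ` I) (cell c) g = fc (\<lambda>a. g (c a))"
proof -
  interpret C: proj_family e "c ` I" "cell c" by (rule proj_family_cell)
  have "fc (\<lambda>a. g (c a)) = (\<Sum>i\<in>c ` I. \<Sum>a\<in>{a\<in>I. c a = i}. g (c a) *\<^sub>R p a)"
    unfolding fc_def by (rule sum.image_gen[OF fin])
  also have "\<dots> = C.fc g"
    unfolding C.fc_def cell_def by (simp add: scaleR_sum_right)
  finally show ?thesis by simp
qed

lemma commute_fc_if_commute_p:
  assumes "\<And>a. a \<in> I \<Longrightarrow> y * p a = p a * y"
  shows "y * fc f = fc f * y"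
  using assms by (simp add: fc_def sum_distrib_left sum_distrib_right)

end

subsection \<open>Weighted contractions\<close>

definition hermitian :: "nat \<Rightarrow> fsmat \<Rightarrow> bool" where
  "hermitian n x \<longleftrightarrow> supp_below n x \<and> adj x = x"

lemma hermitianD:
  assumes "hermitian n x"
  shows "adj x = x" "idm n * x = x" "x * idm n = x" "supp_below n x"
  using assms by (auto simp: hermitian_def supp_below_iff_idm)

lemma hermitianI: "adj x = x \<Longrightarrow> idm n * x = x \<Longrightarrow> x * idm n = x \<Longrightarrow> hermitian n x"
  by (simp add: hermitian_def supp_below_iff_idm)

text \<open>One step of the iteration: \<open>a m\<close> is discretised and every other
  \<open>a j\<close> is pinched along its spectral cells. Distances are measured with the weight
  \<open>r\<close>, so the shift is chosen for the elements \<open>r * a j\<close>. The conclusions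
  about \<open>y\<close> and about unchanged \<open>b j\<close> preserve the commutation relations
  already obtained.\<close>

lemma pinching_step:
  fixes a :: "'j \<Rightarrow> fsmat" and K s \<delta> \<eta> :: real and M :: nat
  assumes J: "finite J" "m \<in> J"
    and a: "\<And>j. j \<in> J \<Longrightarrow> hermitian n (a j)" "\<And>j. j \<in> J \<Longrightarrow> op_bound 1 (a j)"
    and r: "hermitian n r" "\<And>j. j \<in> J \<Longrightarrow> r * a j = a j * r" "norm r \<le> K * s"
    and comm: "\<And>j. j \<in> J \<Longrightarrow> norm (r * (a m * a j - a j * a m)) \<le> \<delta> * s"
    and pos: "\<eta> > 0" "M > 0" "\<delta> \<ge> 0" "s \<ge> 0"
  obtains b where "\<And>j. j \<in> J \<Longrightarrow> hermitian n (b j)" "\<And>j. j \<in> J \<Longrightarrow> op_bound 1 (b j)"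
    "\<And>j. j \<in> J \<Longrightarrow> b j * b m = b m * b j"
    "\<And>y j. j \<in> J \<Longrightarrow> supp_below n y \<Longrightarrow> y * a m = a m * y \<Longrightarrow> y * a j = a j * y \<Longrightarrow> y * b j = b j * y"
    "\<And>j. j \<in> J \<Longrightarrow> j \<noteq> m \<Longrightarrow> a j * a m = a m * a j \<Longrightarrow> b j = a j"
    "\<And>j. j \<in> J \<Longrightarrow> j \<noteq> m \<Longrightarrow> (norm (r * (a j - b j)))\<^sup>2 \<le> real (card J) * (K * \<delta> / \<eta> + K\<^sup>2 / real M) * s\<^sup>2"
    "norm (r * (a m - b m)) \<le> \<eta> * (K * s)"
proof -
  note hr = hermitianD[OF r(1)]
  note ha = hermitianD[OF a(1)]
  obtain p l where p: "proj_family (idm n) {..<n} p" "\<And>a. a < n \<Longrightarrow> p a \<noteq> 0"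
    "a m = proj_family.fc {..<n} p l"
    using spectral_hermitian[OF ha(4,1)[OF J(2)]] by blast
  interpret P: proj_family "idm n" "{..<n}" p by (rule p(1))
  have l1: "\<bar>l i\<bar> \<le> 1" if "i < n" for i
  proof -
    have "\<bar>l i\<bar> * norm (p i) = norm (a m * p i)"
      using that by (simp add: p(3) P.fc_p)
    also have "\<dots> \<le> 1 * norm (p i)" by (rule op_boundD[OF a(2)[OF J(2)]])
    finally show ?thesis using p(2)[OF that] by (simp add: mult_le_cancel_right)
  qed
  define x where "x j = r * a j" for j
  have x_corner: "idm n * x j = x j" "x j * idm n = x j" if "j \<in> J" for j
    using hr ha[OF that] by (simp_all add: x_def mult.assoc) (simp_all add: mult.assoc[symmetric])
  have x_norm: "norm (x j) \<le> K * s" if "j \<in> J" for j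
    using op_bound_right[OF a(2)[OF that], of r] r(3) by (simp add: x_def)
  \<comment> \<open>Labels are divided by \<open>\<eta>\<close> so that unit cells become spectral
    intervals of length \<open>\<eta>\<close>. As \<open>r\<close> commutes with \<open>a m\<close>,
    the commutator of \<open>a m\<close> with \<open>r * a j\<close> is the weighted
    commutator.\<close>
  have x_comm: "(\<Sum>i<n. \<Sum>k<n. (l i / \<eta> - l k / \<eta>)\<^sup>2 * (norm (p i * x j * p k))\<^sup>2) \<le> (\<delta> * s / \<eta>)\<^sup>2" if "j \<in> J" for j
  proof -
    have "a m * (r * a j) - r * a j * a m = r * (a m * a j - a j * a m)"
      using r(2)[OF J(2)] by (simp add: right_diff_distrib mult.assoc[symmetric])
    then have eq: "P.fc l * x j - x j * P.fc l = r * (a m * a j - a j * a m)"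
      by (simp add: x_def flip: p(3))
    have "(\<Sum>i<n. \<Sum>k<n. (l i / \<eta> - l k / \<eta>)\<^sup>2 * (norm (p i * x j * p k))\<^sup>2)
        = (\<Sum>i<n. \<Sum>k<n. (l i - l k)\<^sup>2 * (norm (p i * x j * p k))\<^sup>2) / \<eta>\<^sup>2"
      unfolding sum_divide_distrib
      by (intro sum.cong refl) (simp add: power_divide flip: diff_divide_distrib)
    also have "\<dots> = (norm (r * (a m * a j - a j * a m)))\<^sup>2 / \<eta>\<^sup>2"
      using P.norm_commutator_fc[OF x_corner[OF that], of l] by (simp add: eq)
    also have "\<dots> \<le> (\<delta> * s)\<^sup>2 / \<eta>\<^sup>2"
      by (intro divide_right_mono power_mono comm that) auto
    finally show ?thesis by (simp add: power_divide)
  qed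
  obtain t :: real where t: "0 \<le> t" "t < 1" and
    loss: "\<And>j. j \<in> J \<Longrightarrow> (norm (x j - proj_family.pinch ((\<lambda>i. \<lfloor>l i / \<eta> + t\<rfloor>) ` {..<n})
        (P.cell (\<lambda>i. \<lfloor>l i / \<eta> + t\<rfloor>)) (x j)))\<^sup>2 \<le> real (card J) * (K * s * (\<delta> * s / \<eta>) + (K * s)\<^sup>2 / real M)"
    by (rule P.exists_good_pinching[of J M "\<delta> * s / \<eta>" x "K * s" "\<lambda>i. l i / \<eta>"])
       (use J pos x_corner x_norm x_comm in auto)
  define c where "c i = \<lfloor>l i / \<eta> + t\<rfloor>" for i
  interpret C: proj_family "idm n" "c ` {..<n}" "P.cell c" by (rule P.proj_family_cell)
  \<comment> \<open>Each cell is represented by an eigenvalue that occurs in it, so the discretised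
    \<open>a m\<close> is still a contraction.\<close>
  define rep where "rep k = (SOME i. i < n \<and> c i = k)" for k
  have rep: "rep (c i) < n" "c (rep (c i)) = c i" if "i < n" for i
    using someI[of "\<lambda>i'. i' < n \<and> c i' = c i" i] that by (auto simp: rep_def)
  define g where "g i = l (rep (c i))" for i
  have lg: "\<bar>l i - g i\<bar> \<le> \<eta>" if "i < n" for i
  proof -
    have "\<lfloor>l i / \<eta> + t\<rfloor> = \<lfloor>g i / \<eta> + t\<rfloor>" using rep(2)[OF that] by (simp add: c_def g_def)
    then have "\<bar>l i / \<eta> - g i / \<eta>\<bar> \<le> 1" by linarith
    then have "\<bar>l i - g i\<bar> / \<eta> \<le> 1" using pos(1) by (simp flip: diff_divide_distrib)
    then show ?thesis using pos(1) by simp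
  qed
  have fcg: "P.fc g = C.fc (\<lambda>k. l (rep k))" by (simp add: P.fc_cell g_def[abs_def])
  \<comment> \<open>The cells and \<open>P.fc g\<close> are functions of \<open>a m\<close>, so they
    inherit all of its commutation relations.\<close>
  have commute_cell: "y * P.cell c k = P.cell c k * y" and commute_g: "y * P.fc g = P.fc g * y"
    if y: "supp_below n y" "y * a m = a m * y" for y k
  proof -
    have y': "y * P.fc l = P.fc l * y" "idm n * y = y" "y * idm n = y"
      using y by (auto simp: p(3) supp_below_iff_idm)
    show "y * P.cell c k = P.cell c k * y"
      unfolding P.cell_eq_fc by (rule P.commute_fc[OF y']) (simp add: c_def)
    show "y * P.fc g = P.fc g * y"
      by (rule P.commute_fc[OF y']) (simp add: c_def g_def)
  qed
  define b where "b j = (if j = m then P.fc g else C.pinch (a j))" for j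
  have r_cell: "r * P.cell c k = P.cell c k * r" for k
    by (rule commute_cell) (use hr r(2)[OF J(2)] in auto)
  show ?thesis
  proof (rule that)
    fix j assume j: "j \<in> J"
    show "hermitian n (b j)"
      using ha[OF j] by (intro hermitianI) (simp_all add: b_def C.adj_pinch)
    show "op_bound 1 (b j)"
      using a(2)[OF j] l1 rep(1) by (auto simp: b_def g_def intro!: C.op_bound_pinch P.op_bound_fc)
    have "C.pinch (a j) * P.fc g = P.fc g * C.pinch (a j)"
      unfolding fcg by (rule C.commute_fc_if_commute_p) (rule C.pinch_commute_p)
    then show "b j * b m = b m * b j" by (simp add: b_def)
    show "y * b j = b j * y" if "supp_below n y" "y * a m = a m * y" "y * a j = a j * y" for y
      using commute_cell[OF that(1,2)] commute_g[OF that(1,2)] that(3) by (simp add: b_def C.commute_pinch)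
    show "b j = a j" if "j \<noteq> m" "a j * a m = a m * a j"
      using that commute_cell[OF ha(4)[OF j] that(2)] ha(3)[OF j] by (simp add: b_def C.pinch_commuting)
    show "(norm (r * (a j - b j)))\<^sup>2 \<le> real (card J) * (K * \<delta> / \<eta> + K\<^sup>2 / real M) * s\<^sup>2" if "j \<noteq> m"
    proof -
      have "r * (a j - b j) = x j - C.pinch (x j)"
        using that r_cell by (simp add: b_def x_def right_diff_distrib C.pinch_mult_left)
      then have "(norm (r * (a j - b j)))\<^sup>2 \<le> real (card J) * (K * s * (\<delta> * s / \<eta>) + (K * s)\<^sup>2 / real M)"
        using loss[OF j] by (simp add: c_def[abs_def])
      also have "\<dots> = real (card J) * (K * \<delta> / \<eta> + K\<^sup>2 / real M) * s\<^sup>2"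
        by (simp add: algebra_simps power2_eq_square)
      finally show ?thesis .
    qed
  next
    have "a m - b m = P.fc (\<lambda>i. l i - g i)" by (simp add: b_def p(3) P.fc_diff)
    then have "op_bound \<eta> (a m - b m)" using lg pos(1) by (auto intro!: P.op_bound_fc)
    then have "norm (r * (a m - b m)) \<le> \<eta> * norm r" by (rule op_bound_right)
    also have "\<dots> \<le> \<eta> * (K * s)" using pos(1) r(3) by (intro mult_left_mono) auto
    finally show "norm (r * (a m - b m)) \<le> \<eta> * (K * s)" .
  qed
qed

text \<open>Each product changes by \<open>r * (a - a') * b'\<close> and
  \<open>a * (r * (b - b'))\<close> up to sign, the weight having been moved past \<open>a\<close>.
  The unweighted factors are contractions, so every one of the four terms costs at most
  \<open>L\<close>.\<close>

lemma norm_weighted_commutator_perturb: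
  fixes r a a' b b' :: fsmat
  assumes "op_bound 1 a" "op_bound 1 a'" "op_bound 1 b" "op_bound 1 b'"
    and "r * a = a * r" "r * b = b * r"
    and "norm (r * (a - a')) \<le> L" "norm (r * (b - b')) \<le> L"
  shows "norm (r * (a' * b' - b' * a')) \<le> norm (r * (a * b - b * a)) + 4 * L"
proof -
  have 1: "norm (r * (a' * b' - a * b)) \<le> 2 * L"
    if "op_bound 1 a" "op_bound 1 b'" "r * a = a * r" "norm (r * (a - a')) \<le> L" "norm (r * (b - b')) \<le> L"
    for a a' b b' :: fsmat
  proof -
    have "r * (a' * b' - a * b) = - (r * (a - a') * b') - a * (r * (b - b'))"
      using that(3) by (simp add: algebra_simps) (simp flip: mult.assoc add: that(3))
    then have "norm (r * (a' * b' - a * b)) \<le> norm (r * (a - a') * b') + norm (a * (r * (b - b')))"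
      by (metis norm_minus_cancel norm_triangle_ineq4)
    then show ?thesis
      using op_bound_right[OF that(2), of "r * (a - a')"] op_boundD[OF that(1), of "r * (b - b')"] that(4,5)
      by linarith
  qed
  have "r * (a' * b' - b' * a') = r * (a * b - b * a) + r * (a' * b' - a * b) - r * (b' * a' - b * a)"
    by (simp add: algebra_simps)
  then have "norm (r * (a' * b' - b' * a'))
      \<le> norm (r * (a * b - b * a)) + norm (r * (a' * b' - a * b)) + norm (r * (b' * a' - b * a))"
    by (metis add_mono_thms_linordered_semiring(3) norm_triangle_ineq norm_triangle_ineq4 order_trans)
  then show ?thesis using 1[of a b' a' b] 1[of b a' b' a] assms by linarith
qed

text \<open>\<open>U\<close> is the set of indices not yet treated: the matrices outside \<open>U\<close> already commute with all
  others, and pinching along one of \<open>U\<close> leaves them unchanged.\<close>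

lemma weighted_contractions_near_commuting:
  fixes J U :: "'j set" and K :: real
  assumes J: "finite J" and K: "K > 0" and "finite U" "U \<subseteq> J" "\<epsilon> > 0"
  shows "\<exists>\<delta>>0. \<forall>n s r. \<forall>a :: 'j \<Rightarrow> fsmat.
    0 \<le> s \<and> hermitian n r \<and> norm r \<le> K * s \<and>
    (\<forall>j\<in>J. hermitian n (a j) \<and> op_bound 1 (a j) \<and> r * a j = a j * r) \<and>
    (\<forall>i\<in>J - U. \<forall>j\<in>J. a i * a j = a j * a i) \<and>
    (\<forall>i\<in>J. \<forall>j\<in>J. norm (r * (a i * a j - a j * a i)) \<le> \<delta> * s) \<longrightarrow>
    (\<exists>b. (\<forall>j\<in>J. hermitian n (b j) \<and> r * b j = b j * r) \<and>
      (\<forall>i\<in>J. \<forall>j\<in>J. b i * b j = b j * b i) \<and>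
      (\<forall>j\<in>J. norm (r * (a j - b j)) \<le> \<epsilon> * s))"
  using assms(3-5)
proof (induction U arbitrary: \<epsilon> rule: finite_induct)
  case empty
  show ?case
  proof (rule exI[of _ 1], intro conjI allI impI)
    fix n s r and a :: "'j \<Rightarrow> fsmat"
    assume *: "0 \<le> s \<and> hermitian n r \<and> norm r \<le> K * s \<and>
      (\<forall>j\<in>J. hermitian n (a j) \<and> op_bound 1 (a j) \<and> r * a j = a j * r) \<and>
      (\<forall>i\<in>J - {}. \<forall>j\<in>J. a i * a j = a j * a i) \<and>
      (\<forall>i\<in>J. \<forall>j\<in>J. norm (r * (a i * a j - a j * a i)) \<le> 1 * s)"
    show "\<exists>b. (\<forall>j\<in>J. hermitian n (b j) \<and> r * b j = b j * r) \<and>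
      (\<forall>i\<in>J. \<forall>j\<in>J. b i * b j = b j * b i) \<and>
      (\<forall>j\<in>J. norm (r * (a j - b j)) \<le> \<epsilon> * s)"
      by (rule exI[of _ a]) (use * empty in simp)
  qed simp
next
  case (insert m U)
  have m: "m \<in> J" and \<epsilon>: "\<epsilon> > 0" using insert.prems by auto
  from insert.IH[of "\<epsilon> / 2"] insert.prems obtain \<delta>' where \<delta>': "\<delta>' > 0" and
    IH: "\<And>n s r a. 0 \<le> s \<and> hermitian n r \<and> norm r \<le> K * s \<and>
      (\<forall>j\<in>J. hermitian n (a j) \<and> op_bound 1 (a j) \<and> r * a j = a j * r) \<and>
      (\<forall>i\<in>J - U. \<forall>j\<in>J. a i * a j = a j * a i) \<and>
      (\<forall>i\<in>J. \<forall>j\<in>J. norm (r * (a i * a j - a j * a i)) \<le> \<delta>' * s) \<Longrightarrow>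
      \<exists>b. (\<forall>j\<in>J. hermitian n (b j) \<and> r * b j = b j * r) \<and>
      (\<forall>i\<in>J. \<forall>j\<in>J. b i * b j = b j * b i) \<and>
      (\<forall>j\<in>J. norm (r * (a j - b j)) \<le> \<epsilon> / 2 * s)"
    by auto
  \<comment> \<open>The allowed change of each matrix other than \<open>a m\<close>: it fits into
    \<open>\<epsilon> / 2\<close>, and \<open>4 * L\<close> uses at most half of
    \<open>\<delta>'\<close>.\<close>
  define L where "L = min (\<epsilon> / 2) (\<delta>' / 8)"
  have L: "L > 0" "L \<le> \<epsilon> / 2" "4 * L \<le> \<delta>' / 2" using \<epsilon> \<delta>' by (auto simp: L_def)
  \<comment> \<open>With this cell length the discretisation of \<open>a m\<close> costs at most
    \<open>\<epsilon> / 2 * s\<close>.\<close>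
  define \<eta> where "\<eta> = \<epsilon> / (2 * K)"
  have \<eta>: "\<eta> > 0" "\<eta> * K = \<epsilon> / 2" using \<epsilon> K by (auto simp: \<eta>_def)
  define N where "N = real (card J)"
  have N: "N > 0" using m J by (auto simp: N_def card_gt_0_iff)
  \<comment> \<open>Enough shifts to keep the averaging error within half of
    \<open>L\<^sup>2\<close>; the second entry of \<open>\<delta>\<close> below reserves the other
    half for the commutator term.\<close>
  obtain M :: nat where M0: "2 * N * K\<^sup>2 / L\<^sup>2 < real M" using reals_Archimedean2 by blast
  moreover have "0 \<le> 2 * N * K\<^sup>2 / L\<^sup>2" using N by simp
  ultimately have M: "M > 0" by (metis less_le_trans not_gr_zero of_nat_0 not_less)
  have M': "N * (K\<^sup>2 / real M) \<le> L\<^sup>2 / 2"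
    using M0 M L(1) by (simp add: field_simps)
  define \<delta> where "\<delta> = min (\<delta>' / 2) (L\<^sup>2 * \<eta> / (2 * N * K))"
  have \<delta>: "\<delta> > 0" "\<delta> \<le> \<delta>' / 2" "\<delta> \<le> L\<^sup>2 * \<eta> / (2 * N * K)"
    using \<delta>' L \<eta> N K by (auto simp: \<delta>_def)
  have "N * (K * \<delta> / \<eta>) \<le> N * (K * (L\<^sup>2 * \<eta> / (2 * N * K)) / \<eta>)"
    using N K \<eta> \<delta> by (intro mult_left_mono divide_right_mono) auto
  also have "\<dots> = L\<^sup>2 / 2" using N K \<eta>(1) by simp
  finally have loss: "N * (K * \<delta> / \<eta> + K\<^sup>2 / real M) \<le> L\<^sup>2"
    using M' unfolding distrib_left by linarith
  show ?case
  proof (rule exI[of _ \<delta>], intro conjI allI impI)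
    fix n s r and a :: "'j \<Rightarrow> fsmat"
    assume *: "0 \<le> s \<and> hermitian n r \<and> norm r \<le> K * s \<and>
      (\<forall>j\<in>J. hermitian n (a j) \<and> op_bound 1 (a j) \<and> r * a j = a j * r) \<and>
      (\<forall>i\<in>J - insert m U. \<forall>j\<in>J. a i * a j = a j * a i) \<and>
      (\<forall>i\<in>J. \<forall>j\<in>J. norm (r * (a i * a j - a j * a i)) \<le> \<delta> * s)"
    then have s: "0 \<le> s" by blast
    obtain a' where a': "\<And>j. j \<in> J \<Longrightarrow> hermitian n (a' j)" "\<And>j. j \<in> J \<Longrightarrow> op_bound 1 (a' j)"
      "\<And>j. j \<in> J \<Longrightarrow> a' j * a' m = a' m * a' j"
      "\<And>y j. j \<in> J \<Longrightarrow> supp_below n y \<Longrightarrow> y * a m = a m * y \<Longrightarrow> y * a j = a j * y \<Longrightarrow> y * a' j = a' j * y"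
      "\<And>j. j \<in> J \<Longrightarrow> j \<noteq> m \<Longrightarrow> a j * a m = a m * a j \<Longrightarrow> a' j = a j"
      "\<And>j. j \<in> J \<Longrightarrow> j \<noteq> m \<Longrightarrow> (norm (r * (a j - a' j)))\<^sup>2 \<le> real (card J) * (K * \<delta> / \<eta> + K\<^sup>2 / real M) * s\<^sup>2"
      "norm (r * (a m - a' m)) \<le> \<eta> * (K * s)"
      by (rule pinching_step[OF J m, of n a r K s \<delta> \<eta> M]) (use * \<eta> M \<delta> m in auto)
    have r_a': "r * a' j = a' j * r" if "j \<in> J" for j
      by (rule a'(4)[OF that]) (use * m that in \<open>auto dest: hermitianD\<close>)
    have dist_L: "norm (r * (a j - a' j)) \<le> L * s" if "j \<in> J" "j \<noteq> m" for j
    proof (rule power2_le_imp_le)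
      have "(norm (r * (a j - a' j)))\<^sup>2 \<le> N * (K * \<delta> / \<eta> + K\<^sup>2 / real M) * s\<^sup>2"
        using a'(6)[OF that] by (simp add: N_def)
      also have "\<dots> \<le> L\<^sup>2 * s\<^sup>2" by (intro mult_right_mono loss) simp
      finally show "(norm (r * (a j - a' j)))\<^sup>2 \<le> (L * s)\<^sup>2" by (simp add: power_mult_distrib)
    qed (use L s in simp)
    have dist: "norm (r * (a j - a' j)) \<le> \<epsilon> / 2 * s" if "j \<in> J" for j
    proof (cases "j = m")
      case True
      then show ?thesis using a'(7) \<eta>(2) by (simp add: mult.assoc[symmetric])
    next
      case False
      have "L * s \<le> \<epsilon> / 2 * s" using L s by (intro mult_right_mono) auto
      then show ?thesis using dist_L[OF that False] by linarith
    qed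
    have comm': "a' i * a' j = a' j * a' i" if ij: "i \<in> J - U" "j \<in> J" for i j
    proof (cases "i = m")
      case True
      then show ?thesis using a'(3)[OF ij(2)] by simp
    next
      case False
      then have i: "i \<in> J - insert m U" using ij by auto
      then have "a' i = a i" using * m by (intro a'(5)) auto
      moreover have "a i * a' j = a' j * a i"
        by (rule a'(4)[OF ij(2)]) (use * m i ij in \<open>auto dest: hermitianD\<close>)
      ultimately show ?thesis by simp
    qed
    have near: "norm (r * (a' i * a' j - a' j * a' i)) \<le> \<delta>' * s" if ij: "i \<in> J" "j \<in> J" for i j
    proof (cases "i = m \<or> j = m")
      case True
      then have "a' i * a' j = a' j * a' i" using a'(3)[OF ij(1)] a'(3)[OF ij(2)] by auto
      then show ?thesis using \<delta>' s by simp
    next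
      case False
      have "norm (r * (a' i * a' j - a' j * a' i)) \<le> norm (r * (a i * a j - a j * a i)) + 4 * (L * s)"
        by (rule norm_weighted_commutator_perturb) (use * ij a' dist_L False in auto)
      also have "\<dots> \<le> \<delta> * s + 4 * (L * s)" using * ij by auto
      also have "\<dots> = (\<delta> + 4 * L) * s" by (simp add: algebra_simps)
      also have "\<dots> \<le> \<delta>' * s" using \<delta> L s by (intro mult_right_mono) auto
      finally show ?thesis .
    qed
    have "\<exists>b. (\<forall>j\<in>J. hermitian n (b j) \<and> r * b j = b j * r) \<and>
      (\<forall>i\<in>J. \<forall>j\<in>J. b i * b j = b j * b i) \<and>
      (\<forall>j\<in>J. norm (r * (a' j - b j)) \<le> \<epsilon> / 2 * s)"
      by (rule IH[of s n r a']) (use * a' r_a' comm' near in blast)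
    then obtain b where b: "\<forall>j\<in>J. hermitian n (b j) \<and> r * b j = b j * r"
      "\<forall>i\<in>J. \<forall>j\<in>J. b i * b j = b j * b i" "\<And>j. j \<in> J \<Longrightarrow> norm (r * (a' j - b j)) \<le> \<epsilon> / 2 * s" by blast
    have "norm (r * (a j - b j)) \<le> \<epsilon> * s" if "j \<in> J" for j
    proof -
      have "r * (a j - b j) = r * (a j - a' j) + r * (a' j - b j)" by (simp add: algebra_simps)
      then have "norm (r * (a j - b j)) \<le> norm (r * (a j - a' j)) + norm (r * (a' j - b j))"
        by (simp add: norm_triangle_ineq)
      also have "\<dots> \<le> \<epsilon> / 2 * s + \<epsilon> / 2 * s" by (intro add_mono dist b(3) that)
      finally show ?thesis by simp
    qed
    then show "\<exists>b. (\<forall>j\<in>J. hermitian n (b j) \<and> r * b j = b j * r) \<and>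
      (\<forall>i\<in>J. \<forall>j\<in>J. b i * b j = b j * b i) \<and>
      (\<forall>j\<in>J. norm (r * (a j - b j)) \<le> \<epsilon> * s)"
      using b by blast
  qed (rule \<delta>(1))
qed

subsection \<open>Hermitian matrices\<close>

lemma ln_diff_sq_le:
  fixes x y :: real
  assumes "x > 0" "y > 0"
  shows "(ln x - ln y)\<^sup>2 \<le> 4 * ((x - y)\<^sup>2 / (x * y))"
proof -
  have *: "(ln x - ln y)\<^sup>2 \<le> 4 * ((x - y)\<^sup>2 / (x * y))" if "x > 0" "x \<le> y" for x y :: real
  proof -
    have y: "y > 0" using that by simp
    let ?u = "sqrt x" and ?v = "sqrt y"
    have uv: "?u > 0" "?v > 0" "?u \<le> ?v" "?u\<^sup>2 = x" "?v\<^sup>2 = y" using that y by auto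
    \<comment> \<open>Passing to square roots before using \<open>ln z \<le> z - 1\<close> yields
      the symmetric denominator \<open>sqrt x * sqrt y\<close>.\<close>
    have "ln y - ln x = 2 * (ln (?v / ?u))"
      using that y uv by (simp add: ln_div ln_sqrt)
    also have "\<dots> \<le> 2 * (?v / ?u - 1)"
      using uv by (intro mult_left_mono ln_le_minus_one) auto
    also have "\<dots> = 2 * ((?v - ?u) * ?v / (?u * ?v))" using uv by (simp add: field_simps)
    also have "\<dots> \<le> 2 * ((y - x) / (?u * ?v))"
    proof (intro mult_left_mono divide_right_mono)
      have "?u * ?u \<le> ?u * ?v" using uv by (intro mult_left_mono) auto
      then show "(?v - ?u) * ?v \<le> y - x"
        using uv(4,5) by (simp add: algebra_simps power2_eq_square)
    qed (use uv in auto)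
    finally have "(ln y - ln x)\<^sup>2 \<le> (2 * ((y - x) / (?u * ?v)))\<^sup>2"
      using that y by (intro power_mono) auto
    also have "\<dots> = 4 * ((x - y)\<^sup>2 / (x * y))"
      using uv(4,5) by (simp only: power_divide power_mult_distrib power2_commute[of y x]) simp
    finally show ?thesis by (simp add: power2_commute[of "ln y" "ln x"])
  qed
  show ?thesis
  proof (cases "x \<le> y")
    case True
    then show ?thesis using * assms by blast
  next
    case False
    then show ?thesis using *[of y x] assms by (simp add: power2_commute[of x y] power2_commute[of "ln x" "ln y"] mult.commute)
  qed
qed

text \<open>The right side carries the block coefficients of the pairing of the commutator with
  \<open>g\<^sup>2\<close> against
  \<open>A g\<^sup>-\<^sup>2 - g\<^sup>-\<^sup>1 A g\<^sup>-\<^sup>1\<close>, where \<open>x\<close>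
  is the row value of \<open>g\<close> and \<open>y\<close> the column value. It splits into two
  squares, one of which controls the logarithms.\<close>

lemma ln_diff_sq_le_weight:
  fixes x y :: real
  assumes "x > 0" "y > 0"
  shows "(ln x - ln y)\<^sup>2 \<le> 4 * ((x\<^sup>2 - y\<^sup>2) * (1 / y\<^sup>2 - 1 / (x * y)))"
proof -
  have "(x\<^sup>2 - y\<^sup>2) * (1 / y\<^sup>2 - 1 / (x * y)) = (x - y)\<^sup>2 / (x * y) + (x - y)\<^sup>2 / y\<^sup>2"
    using assms by (simp add: field_simps power2_eq_square)
  moreover have "0 \<le> (x - y)\<^sup>2 / y\<^sup>2" by simp
  ultimately have "(x - y)\<^sup>2 / (x * y) \<le> (x\<^sup>2 - y\<^sup>2) * (1 / y\<^sup>2 - 1 / (x * y))" by linarith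
  then show ?thesis using ln_diff_sq_le[OF assms] by linarith
qed

text \<open>Here \<open>g\<close> gives the square roots of the eigenvalues of \<open>h\<close>, the
  unit plus the sum of the squares \<open>A j * A j\<close>. The squared norm of
  \<open>P.fc g\<close> is the trace of \<open>h\<close>, and since each \<open>A j * A j\<close> is
  dominated by \<open>h\<close>, multiplying \<open>A j\<close> by the inverse of
  \<open>P.fc g\<close> gives a contraction.\<close>

lemma exists_scale:
  fixes A :: "'j \<Rightarrow> fsmat" and s \<delta> :: real
  assumes J: "finite J" and A: "\<And>j. j \<in> J \<Longrightarrow> hermitian n (A j)" "\<And>j. j \<in> J \<Longrightarrow> norm (A j) \<le> s"
    and s: "norm (idm n) \<le> s"
    and comm: "\<And>i j. i \<in> J \<Longrightarrow> j \<in> J \<Longrightarrow> norm (A i * A j - A j * A i) \<le> \<delta> * s"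
  shows "\<exists>p g. proj_family (idm n) {..<n} p \<and> (\<forall>a<n. 1 \<le> g a) \<and>
    (norm (proj_family.fc {..<n} p g))\<^sup>2 \<le> (1 + real (card J)) * s\<^sup>2 \<and>
    (\<forall>j\<in>J. op_bound 1 (A j * proj_family.fc {..<n} p (\<lambda>a. 1 / g a))) \<and>
    (\<forall>j\<in>J. (\<Sum>a<n. \<Sum>b<n. (ln (g a) - ln (g b))\<^sup>2 * (norm (p a * A j * p b))\<^sup>2)
      \<le> 16 * (real (card J) * \<delta>) * s\<^sup>2)"
proof -
  note hA = hermitianD[OF A(1)]
  have s0: "0 \<le> s" using s norm_ge_zero order_trans by blast
  define h where "h = idm n + (\<Sum>j\<in>J. A j * A j)"
  have h: "adj h = h" "idm n * h = h" "h * idm n = h"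
    using hA by (simp_all add: h_def adj_sum sum_distrib_left sum_distrib_right distrib_left distrib_right
        mult.assoc) (simp_all add: mult.assoc[symmetric])
  obtain p \<mu> where p: "proj_family (idm n) {..<n} p" "\<And>a. a < n \<Longrightarrow> p a \<noteq> 0"
    "h = proj_family.fc {..<n} p \<mu>"
    using spectral_hermitian[of n h] h by (auto simp: supp_below_iff_idm)
  interpret P: proj_family "idm n" "{..<n}" p by (rule p(1))
  have inner_h: "inner y (h * y) = (norm y)\<^sup>2 + (\<Sum>j\<in>J. (norm (A j * y))\<^sup>2)" if "idm n * y = y" for y
  proof -
    have "inner y (A j * A j * y) = (norm (A j * y))\<^sup>2" if "j \<in> J" for j
      using inner_mult_adj_left[of "A j" y "A j * y"] hA(1)[OF that] by (simp add: power2_norm_eq_inner mult.assoc)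
    then show ?thesis
      using that by (simp add: h_def distrib_right inner_add_right sum_distrib_right inner_sum_right power2_norm_eq_inner)
  qed
  have \<mu>: "1 \<le> \<mu> a" if "a < n" for a
  proof -
    have "\<mu> a * (norm (p a))\<^sup>2 = inner (p a) (h * p a)"
      using that by (simp add: p(3) P.fc_p power2_norm_eq_inner)
    also have "\<dots> \<ge> (norm (p a))\<^sup>2"
      using that by (subst inner_h) (auto intro!: sum_nonneg)
    finally show ?thesis using p(2)[OF that] by simp
  qed
  define g where "g a = sqrt (\<mu> a)" for a
  have g1: "1 \<le> g a" and g2: "g a * g a = \<mu> a" if "a < n" for a
    using \<mu>[OF that] by (auto simp: g_def)
  let ?G = "P.fc g" and ?H = "P.fc (\<lambda>a. 1 / g a)"
  have GG: "?G * ?G = h"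
    unfolding P.fc_mult p(3) by (rule P.fc_cong) (simp add: g2)
  have "?G * ?H = P.fc (\<lambda>_. 1)"
    unfolding P.fc_mult by (rule P.fc_cong) (use g1 in force)
  then have GH: "?G * ?H = idm n" by (simp add: P.fc_one)
  have "(norm ?G)\<^sup>2 = inner (idm n) (h * idm n)"
    using inner_mult_adj_left[of ?G "idm n" ?G] by (simp add: power2_norm_eq_inner GG h(3))
  also have "\<dots> = (norm (idm n))\<^sup>2 + (\<Sum>j\<in>J. (norm (A j))\<^sup>2)"
    by (subst inner_h) (simp_all add: hA)
  also have "\<dots> \<le> s\<^sup>2 + (\<Sum>j\<in>J. s\<^sup>2)"
    using s A(2) by (intro add_mono sum_mono power_mono) auto
  finally have normG: "(norm ?G)\<^sup>2 \<le> (1 + real (card J)) * s\<^sup>2" by (simp add: algebra_simps)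
  have op_AH: "op_bound 1 (A j * ?H)" if j: "j \<in> J" for j
    unfolding op_bound_def
  proof
    fix x
    define y where "y = ?H * x"
    have y: "idm n * y = y" by (simp add: y_def mult.assoc[symmetric])
    have Gy: "?G * y = idm n * x" by (simp add: y_def mult.assoc[symmetric] GH)
    have "(norm (A j * y))\<^sup>2 \<le> (\<Sum>j\<in>J. (norm (A j * y))\<^sup>2)"
      by (rule member_le_sum[OF j _ J]) simp
    also have "\<dots> \<le> inner y (h * y)" using inner_h[OF y] by simp
    also have "\<dots> = (norm (?G * y))\<^sup>2"
      by (simp add: power2_norm_eq_inner inner_mult_adj_left mult.assoc[symmetric] GG)
    also have "\<dots> \<le> (norm x)\<^sup>2"
      unfolding Gy using op_boundD[OF P.op_bound_e, of x] by (intro power_mono) auto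
    finally have "norm (A j * y) \<le> norm x" by (rule power2_le_imp_le) simp
    then show "norm (A j * ?H * x) \<le> 1 * norm x" by (simp add: y_def mult.assoc)
  qed
  have op_H: "op_bound 1 ?H"
    using g1 by (intro P.op_bound_fc) (force simp: divide_le_eq)+
  have key: "(\<Sum>a<n. \<Sum>b<n. (ln (g a) - ln (g b))\<^sup>2 * (norm (p a * A j * p b))\<^sup>2)
      \<le> 16 * (real (card J) * \<delta>) * s\<^sup>2" if j: "j \<in> J" for j
  proof -
    \<comment> \<open>In the eigenbasis of \<open>h\<close> the pairing \<open>T\<close> is a sum of nonnegative terms, each bounding the
      corresponding term on the left, while \<open>T\<close> is small because \<open>X\<close> is bounded in operator norm.\<close>
    define X where "X = A j * ?H * ?H - ?H * (A j * ?H)"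
    \<comment> \<open>Both terms of \<open>X\<close> are products of the contractions
      \<open>A j * ?H\<close> and \<open>?H\<close>.\<close>
    have op_X: "op_bound 2 X"
      using op_bound_diff[OF op_bound_mult[OF op_AH[OF j] op_H] op_bound_mult[OF op_H op_AH[OF j]]] by (simp add: X_def)
    define T where "T = inner (h * A j - A j * h) X"
    have hA_entry: "p a * (h * A j - A j * h) * p b = (\<mu> a - \<mu> b) *\<^sub>R (p a * A j * p b)" if "a < n" "b < n" for a b
    proof -
      have "p a * (h * A j - A j * h) * p b = (p a * h) * A j * p b - p a * A j * (h * p b)"
        by (simp add: algebra_simps)
      then show ?thesis using that by (simp add: p(3) P.p_fc P.fc_p algebra_simps)
    qed
    have X_entry: "p a * X * p b = (1 / (g b)\<^sup>2 - 1 / (g a * g b)) *\<^sub>R (p a * A j * p b)" if "a < n" "b < n" for a b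
    proof -
      have "p a * X * p b = p a * A j * (?H * (?H * p b)) - (p a * ?H) * A j * (?H * p b)"
        by (simp add: X_def algebra_simps)
      then show ?thesis
        using that by (simp add: P.p_fc P.fc_p algebra_simps power2_eq_square)
    qed
    have corner: "idm n * (h * A j - A j * h) = h * A j - A j * h" "(h * A j - A j * h) * idm n = h * A j - A j * h"
      using h hA[OF j] by (simp_all add: right_diff_distrib left_diff_distrib mult.assoc)
        (simp_all add: mult.assoc[symmetric])
    have "T = (\<Sum>a<n. \<Sum>b<n. inner (p a * (h * A j - A j * h) * p b) (p a * X * p b))"
      unfolding T_def by (rule P.inner_parseval[OF corner])
    also have "\<dots> = (\<Sum>a<n. \<Sum>b<n. ((g a)\<^sup>2 - (g b)\<^sup>2) * (1 / (g b)\<^sup>2 - 1 / (g a * g b)) * (norm (p a * A j * p b))\<^sup>2)"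
      by (intro sum.cong refl) (simp add: hA_entry X_entry g2[symmetric] power2_norm_eq_inner power2_eq_square[of "g _"])
    finally have T: "T = (\<Sum>a<n. \<Sum>b<n. ((g a)\<^sup>2 - (g b)\<^sup>2) * (1 / (g b)\<^sup>2 - 1 / (g a * g b)) * (norm (p a * A j * p b))\<^sup>2)" .
    have "(\<Sum>a<n. \<Sum>b<n. (ln (g a) - ln (g b))\<^sup>2 * (norm (p a * A j * p b))\<^sup>2)
        \<le> (\<Sum>a<n. \<Sum>b<n. 4 * (((g a)\<^sup>2 - (g b)\<^sup>2) * (1 / (g b)\<^sup>2 - 1 / (g a * g b))) * (norm (p a * A j * p b))\<^sup>2)"
    proof (intro sum_mono mult_right_mono)
      fix a b assume "a \<in> {..<n}" "b \<in> {..<n}"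
      then have "1 \<le> g a" "1 \<le> g b" using g1 by auto
      then show "(ln (g a) - ln (g b))\<^sup>2 \<le> 4 * (((g a)\<^sup>2 - (g b)\<^sup>2) * (1 / (g b)\<^sup>2 - 1 / (g a * g b)))"
        by (intro ln_diff_sq_le_weight) auto
    qed simp
    also have "\<dots> = 4 * T" unfolding T by (simp add: sum_distrib_left mult.assoc)
    also have "T \<le> (\<Sum>i\<in>J. 4 * \<delta> * s\<^sup>2)"
    proof -
      \<comment> \<open>The commutator of \<open>A i * A i\<close> with \<open>A j\<close> is
        \<open>A i * c i + c i * A i\<close>. The factors \<open>A i\<close>, for which only the
        Hilbert-Schmidt norm is controlled, are moved across the inner product onto
        \<open>X\<close>, whose operator bound absorbs them.\<close>
      define c where "c i = A i * A j - A j * A i" for i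
      have "h * A j - A j * h = (\<Sum>i\<in>J. A i * c i + c i * A i)"
        using hA[OF j] by (simp add: h_def c_def algebra_simps sum_distrib_left sum_distrib_right sum_subtractf)
      then have "T = (\<Sum>i\<in>J. inner (A i * c i + c i * A i) X)"
        by (simp add: T_def inner_sum_left)
      also have "\<dots> = (\<Sum>i\<in>J. inner (c i) (A i * X + X * A i))"
        using hA(1) by (intro sum.cong refl) (simp add: inner_add_left inner_add_right
          inner_mult_adj_left[of "A _"] inner_mult_adj_right[of _ "A _"])
      also have "\<dots> \<le> (\<Sum>i\<in>J. 4 * \<delta> * s\<^sup>2)"
      proof (rule sum_mono)
        fix i assume i: "i \<in> J"
        have "norm (A i * X) \<le> 2 * norm (A i)" by (rule op_bound_right[OF op_X])
        moreover have "norm (X * A i) \<le> 2 * norm (A i)" by (rule op_boundD[OF op_X])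
        moreover have "norm (A i * X + X * A i) \<le> norm (A i * X) + norm (X * A i)" by (rule norm_triangle_ineq)
        ultimately have n4: "norm (A i * X + X * A i) \<le> 4 * s" using A(2)[OF i] by linarith
        have ci: "norm (c i) \<le> \<delta> * s" unfolding c_def by (rule comm[OF i j])
        have "inner (c i) (A i * X + X * A i) \<le> norm (c i) * norm (A i * X + X * A i)"
          by (rule norm_cauchy_schwarz)
        also have "\<dots> \<le> (\<delta> * s) * (4 * s)"
          by (rule mult_mono[OF ci n4]) (use ci norm_ge_zero[of "c i"] in linarith, simp)
        finally show "inner (c i) (A i * X + X * A i) \<le> 4 * \<delta> * s\<^sup>2" by (simp add: power2_eq_square)
      qed
      finally show ?thesis .
    qed
    finally show ?thesis by (simp add: algebra_simps)
  qed
  show ?thesis using p(1) g1 normG op_AH key by blast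
qed

text \<open>The bound \<open>norm (idm n) \<le> s\<close> makes \<open>s\<close> play the role of \<open>sqrt n\<close>, which turns \<open>tr_norm\<close> into
  the unnormalised norm.\<close>

definition near_commuting :: "(nat \<Rightarrow> fsmat \<Rightarrow> bool) \<Rightarrow> 'j set \<Rightarrow> bool" where
  "near_commuting Q J \<longleftrightarrow> (\<forall>\<epsilon>>0. \<exists>\<delta>>0. \<forall>n s. \<forall>A :: 'j \<Rightarrow> fsmat.
    norm (idm n) \<le> s \<and> (\<forall>j\<in>J. Q n (A j) \<and> norm (A j) \<le> s) \<and>
    (\<forall>i\<in>J. \<forall>j\<in>J. norm (A i * A j - A j * A i) \<le> \<delta> * s) \<longrightarrow>
    (\<exists>B. (\<forall>j\<in>J. Q n (B j)) \<and> (\<forall>i\<in>J. \<forall>j\<in>J. B i * B j = B j * B i) \<and>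
      (\<forall>j\<in>J. norm (A j - B j) \<le> \<epsilon> * s)))"

lemma near_commutingD:
  fixes J :: "'j set"
  assumes "near_commuting Q J" "\<epsilon> > 0"
  shows "\<exists>\<delta>>0. \<forall>n s. \<forall>A :: 'j \<Rightarrow> fsmat.
    norm (idm n) \<le> s \<and> (\<forall>j\<in>J. Q n (A j) \<and> norm (A j) \<le> s) \<and>
    (\<forall>i\<in>J. \<forall>j\<in>J. norm (A i * A j - A j * A i) \<le> \<delta> * s) \<longrightarrow>
    (\<exists>B. (\<forall>j\<in>J. Q n (B j)) \<and> (\<forall>i\<in>J. \<forall>j\<in>J. B i * B j = B j * B i) \<and>
      (\<forall>j\<in>J. norm (A j - B j) \<le> \<epsilon> * s))"
  by (rule assms(1)[unfolded near_commuting_def, THEN spec, THEN mp, OF assms(2)])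

text \<open>After pinching along unit cells of \<open>ln g\<close>, each matrix is a contraction
  times the cellwise constant weight \<open>r\<close>. The bounded case applied to these
  contractions gives \<open>b j\<close>, and \<open>r * b j\<close> is the approximant.\<close>

lemma hermitian_near_commuting:
  fixes J :: "'j set"
  assumes J: "finite J"
  shows "near_commuting hermitian J"
  unfolding near_commuting_def
proof (intro allI impI)
  fix \<epsilon> :: real assume \<epsilon>: "\<epsilon> > 0"
  define k where "k = real (card J)"
  have k: "k \<ge> 0" by (simp add: k_def)
  \<comment> \<open>The factor 3 bounds the number e, the ratio of the ends of a unit cell for
    \<open>ln g\<close>; the root comes from the norm of \<open>P.fc g\<close>.\<close>
  define K where "K = 3 * sqrt (1 + k)"
  have K: "K > 0" using k by (simp add: K_def)
  obtain \<delta>1 where \<delta>1: "\<delta>1 > 0" and bounded: "\<forall>n s r. \<forall>a :: 'j \<Rightarrow> fsmat.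
    0 \<le> s \<and> hermitian n r \<and> norm r \<le> K * s \<and>
    (\<forall>j\<in>J. hermitian n (a j) \<and> op_bound 1 (a j) \<and> r * a j = a j * r) \<and>
    (\<forall>i\<in>J - J. \<forall>j\<in>J. a i * a j = a j * a i) \<and>
    (\<forall>i\<in>J. \<forall>j\<in>J. norm (r * (a i * a j - a j * a i)) \<le> \<delta>1 * s) \<longrightarrow>
    (\<exists>b. (\<forall>j\<in>J. hermitian n (b j) \<and> r * b j = b j * r) \<and>
      (\<forall>i\<in>J. \<forall>j\<in>J. b i * b j = b j * b i) \<and>
      (\<forall>j\<in>J. norm (r * (a j - b j)) \<le> \<epsilon> / 2 * s))"
    using weighted_contractions_near_commuting[OF J K J subset_refl half_gt_zero[OF \<epsilon>]] by blast
  \<comment> \<open>\<open>L * s\<close> bounds the error of the pinching. It enters the distance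
    linearly and the squared weighted commutator as \<open>4 * L\<^sup>2\<close>.\<close>
  define L where "L = min (\<epsilon> / 2) (\<delta>1 / 4)"
  have L: "L > 0" "L \<le> \<epsilon> / 2" "L \<le> \<delta>1 / 4" using \<epsilon> \<delta>1 by (auto simp: L_def)
  have L2: "4 * L\<^sup>2 \<le> \<delta>1\<^sup>2 / 4"
    using power_mono[OF L(3), of 2] L(1) by (simp add: power_divide)
  \<comment> \<open>\<open>4 * q * s\<close> will bound the commutator with \<open>ln g\<close>;
    this choice keeps its share of the squared loss below half of \<open>L\<^sup>2\<close>, and
    \<open>\<delta>\<close> is then chosen with \<open>k * \<delta> \<le> q\<^sup>2\<close>.\<close>
  define q where "q = L\<^sup>2 / (8 * (k + 1))"
  have q: "q > 0" using L k by (simp add: q_def)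
  have kq: "k * (4 * q) \<le> L\<^sup>2 / 2"
    using k L by (simp add: q_def field_simps)
  define \<delta> where "\<delta> = min (\<delta>1\<^sup>2 / 8) (q\<^sup>2 / (k + 1))"
  have \<delta>: "\<delta> > 0" "\<delta> \<le> \<delta>1\<^sup>2 / 8" "\<delta> \<le> q\<^sup>2 / (k + 1)"
    unfolding \<delta>_def by (use \<delta>1 q k in simp) (rule min.cobounded1, rule min.cobounded2)
  have "k * \<delta> \<le> (k + 1) * (q\<^sup>2 / (k + 1))" using k \<delta> by (intro mult_mono) auto
  then have kd: "k * \<delta> \<le> q\<^sup>2" using k by simp
  obtain M :: nat where M0: "2 * k / L\<^sup>2 < real M" using reals_Archimedean2 by blast
  have "0 \<le> 2 * k / L\<^sup>2" using k by simp
  then have M: "M > 0" using M0 by (metis less_le_trans not_gr_zero of_nat_0 not_less)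
  have M': "k / real M \<le> L\<^sup>2 / 2" using M0 M L(1) by (simp add: field_simps)
  show "\<exists>\<delta>>0. \<forall>n s. \<forall>A :: 'j \<Rightarrow> fsmat. norm (idm n) \<le> s \<and>
    (\<forall>j\<in>J. hermitian n (A j) \<and> norm (A j) \<le> s) \<and>
    (\<forall>i\<in>J. \<forall>j\<in>J. norm (A i * A j - A j * A i) \<le> \<delta> * s) \<longrightarrow>
    (\<exists>B. (\<forall>j\<in>J. hermitian n (B j)) \<and> (\<forall>i\<in>J. \<forall>j\<in>J. B i * B j = B j * B i) \<and>
      (\<forall>j\<in>J. norm (A j - B j) \<le> \<epsilon> * s))"
  proof (rule exI[of _ \<delta>], intro conjI allI impI)
    fix n s and A :: "'j \<Rightarrow> fsmat"
    assume *: "norm (idm n) \<le> s \<and> (\<forall>j\<in>J. hermitian n (A j) \<and> norm (A j) \<le> s) \<and>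
      (\<forall>i\<in>J. \<forall>j\<in>J. norm (A i * A j - A j * A i) \<le> \<delta> * s)"
    then have s: "norm (idm n) \<le> s"
      and A: "\<And>j. j \<in> J \<Longrightarrow> hermitian n (A j)" "\<And>j. j \<in> J \<Longrightarrow> norm (A j) \<le> s"
      and comm: "\<And>i j. i \<in> J \<Longrightarrow> j \<in> J \<Longrightarrow> norm (A i * A j - A j * A i) \<le> \<delta> * s"
      by auto
    note hA = hermitianD[OF A(1)]
    have s0: "0 \<le> s" using s norm_ge_zero order_trans by blast
    obtain p g where p: "proj_family (idm n) {..<n} p" and g1: "\<And>a. a < n \<Longrightarrow> 1 \<le> g a"
      and normG: "(norm (proj_family.fc {..<n} p g))\<^sup>2 \<le> (1 + k) * s\<^sup>2"
      and op_AH: "\<And>j. j \<in> J \<Longrightarrow> op_bound 1 (A j * proj_family.fc {..<n} p (\<lambda>a. 1 / g a))"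
      and key: "\<And>j. j \<in> J \<Longrightarrow> (\<Sum>a<n. \<Sum>b<n. (ln (g a) - ln (g b))\<^sup>2 * (norm (p a * A j * p b))\<^sup>2)
        \<le> 16 * (k * \<delta>) * s\<^sup>2"
      using exists_scale[of J n A s \<delta>] J A s comm unfolding k_def by blast
    interpret P: proj_family "idm n" "{..<n}" p by (rule p)
    have key': "(\<Sum>a<n. \<Sum>b<n. (ln (g a) - ln (g b))\<^sup>2 * (norm (p a * A j * p b))\<^sup>2) \<le> (4 * q * s)\<^sup>2" if "j \<in> J" for j
    proof -
      have "16 * (k * \<delta>) * s\<^sup>2 \<le> 16 * q\<^sup>2 * s\<^sup>2" using kd by (intro mult_right_mono mult_left_mono) auto
      then show ?thesis using key[OF that] by (simp add: power_mult_distrib)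
    qed
    obtain t :: real where t: "0 \<le> t" "t < 1" and
      loss: "\<And>j. j \<in> J \<Longrightarrow> (norm (A j - proj_family.pinch ((\<lambda>i. \<lfloor>ln (g i) + t\<rfloor>) ` {..<n})
          (P.cell (\<lambda>i. \<lfloor>ln (g i) + t\<rfloor>)) (A j)))\<^sup>2 \<le> real (card J) * (s * (4 * q * s) + s\<^sup>2 / real M)"
      by (rule P.exists_good_pinching[of J M "4 * q * s" A s "\<lambda>i. ln (g i)"])
         (use J M q s0 hA A(2) key' in auto)
    define c where "c i = \<lfloor>ln (g i) + t\<rfloor>" for i
    interpret C: proj_family "idm n" "c ` {..<n}" "P.cell c" by (rule P.proj_family_cell)
    define A' where "A' j = C.pinch (A j)" for j
    define D where "D j = A j - A' j" for j
    have hA': "adj (A' j) = A' j" "idm n * A' j = A' j" "A' j * idm n = A' j" if "j \<in> J" for j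
      using hA[OF that] by (simp_all add: A'_def C.adj_pinch)
    have normD: "norm (D j) \<le> L * s" if "j \<in> J" for j
    proof (rule power2_le_imp_le)
      have "(norm (D j))\<^sup>2 \<le> k * (s * (4 * q * s) + s\<^sup>2 / real M)"
        using loss[OF that] by (simp add: D_def A'_def c_def[abs_def] k_def)
      also have "\<dots> = (k * (4 * q) + k / real M) * s\<^sup>2" by (simp add: algebra_simps power2_eq_square)
      also have "\<dots> \<le> L\<^sup>2 * s\<^sup>2"
        by (rule mult_right_mono) (use kq M' in linarith, simp)
      finally show "(norm (D j))\<^sup>2 \<le> (L * s)\<^sup>2" by (simp add: power_mult_distrib)
    qed (use L s0 in simp)
    \<comment> \<open>The exponential of the upper end of the cell, so that
      \<open>g \<le> \<rho>\<close> holds and \<open>A' j\<close> divided by the weight is a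
      contraction.\<close>
    define \<rho> where "\<rho> i = exp (real_of_int i + 1 - t)" for i :: int
    have \<rho>: "g i \<le> \<rho> (c i)" "\<rho> (c i) \<le> 3 * g i" if "i < n" for i
    proof -
      have g0: "g i > 0" using g1[OF that] by simp
      have "ln (g i) \<le> real_of_int (c i) + 1 - t" "real_of_int (c i) + 1 - t \<le> ln (g i) + 1"
        unfolding c_def by linarith+
      then have "exp (ln (g i)) \<le> \<rho> (c i)" "\<rho> (c i) \<le> exp (ln (g i) + 1)"
        unfolding \<rho>_def by (simp_all only: exp_le_cancel_iff)
      moreover have "exp (ln (g i) + 1) \<le> 3 * g i"
        using g0 exp_le by (simp add: exp_add mult_left_mono)
      ultimately show "g i \<le> \<rho> (c i)" "\<rho> (c i) \<le> 3 * g i" using g0 by auto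
    qed
    define r where "r = C.fc \<rho>"
    define r' where "r' = C.fc (\<lambda>i. 1 / \<rho> i)"
    have r_eq: "r = P.fc (\<lambda>i. \<rho> (c i))" and r'_eq: "r' = P.fc (\<lambda>i. 1 / \<rho> (c i))"
      by (simp_all add: r_def r'_def P.fc_cell)
    have rr': "r * r' = idm n" "r' * r = idm n"
      unfolding r_def r'_def C.fc_mult by (simp_all add: \<rho>_def C.fc_one)
    have hr: "hermitian n r" by (intro hermitianI) (simp_all add: r_def)
    have "r = P.fc (\<lambda>i. \<rho> (c i) / g i) * P.fc g"
      unfolding r_eq P.fc_mult by (rule P.fc_cong) (use g1 in force)
    moreover have "op_bound 3 (P.fc (\<lambda>i. \<rho> (c i) / g i))"
    proof (rule P.op_bound_fc)
      fix i assume "i \<in> {..<n}"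
      then show "\<bar>\<rho> (c i) / g i\<bar> \<le> 3"
        using \<rho>[of i] g1[of i] by (simp add: divide_le_eq \<rho>_def)
    qed simp
    ultimately have "norm r \<le> 3 * norm (P.fc g)" using op_boundD by metis
    also have "norm (P.fc g) \<le> sqrt (1 + k) * s"
      by (rule power2_le_imp_le) (use normG k s0 in \<open>simp_all add: power_mult_distrib\<close>)
    finally have normr: "norm r \<le> K * s" by (simp add: K_def)
    have commute_pinch: "r * C.pinch x = C.pinch x * r" "r' * C.pinch x = C.pinch x * r'" for x
      unfolding r_def r'_def by (rule C.commute_fc_if_commute_p[symmetric], erule C.pinch_commute_p)+
    define a where "a j = r' * A' j" for j
    have a_eq: "a j = A' j * r'" for j by (simp add: a_def A'_def commute_pinch)
    have r_p: "r * P.cell c i = P.cell c i * r" "r' * P.cell c i = P.cell c i * r'" if "i \<in> c ` {..<n}" for i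
      using that by (simp_all add: r_def r'_def C.fc_p C.p_fc)
    have ra: "r * a j = A' j" if "j \<in> J" for j
      using rr'(1) hA'[OF that] by (simp add: a_def mult.assoc[symmetric])
    have ar: "a j * r = A' j" if "j \<in> J" for j
      using rr'(2) hA'[OF that] by (simp add: a_eq mult.assoc)
    have ha: "hermitian n (a j)" if "j \<in> J" for j
    proof (rule hermitianI)
      have "adj (a j) = A' j * r'" unfolding a_def using hA'[OF that] by (simp add: r'_def)
      then show "adj (a j) = a j" by (simp add: a_eq)
      show "idm n * a j = a j" by (simp add: a_def r'_def mult.assoc[symmetric])
      show "a j * idm n = a j" by (simp add: a_eq r'_def mult.assoc)
    qed
    have op_a: "op_bound 1 (a j)" if "j \<in> J" for j
    proof -
      have "a j = C.pinch (A j * r')"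
        unfolding a_eq A'_def by (rule C.pinch_mult_right[symmetric]) (rule r_p)
      moreover have "r' = P.fc (\<lambda>i. 1 / g i) * P.fc (\<lambda>i. g i / \<rho> (c i))"
        unfolding r'_eq P.fc_mult by (rule P.fc_cong) (use g1 in force)
      moreover have "op_bound 1 (P.fc (\<lambda>i. g i / \<rho> (c i)))"
      proof (rule P.op_bound_fc)
        fix i assume "i \<in> {..<n}"
        then show "\<bar>g i / \<rho> (c i)\<bar> \<le> 1"
          using \<rho>[of i] g1[of i] by (simp add: divide_le_eq \<rho>_def)
      qed simp
      ultimately show ?thesis
        using op_bound_mult[OF op_AH[OF that], of 1 "P.fc (\<lambda>i. g i / \<rho> (c i))"]
        by (auto simp: mult.assoc intro!: C.op_bound_pinch)
    qed
    \<comment> \<open>The squared norm of \<open>r * z\<close> is the pairing of \<open>z\<close>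
      with the commutator of \<open>A' i\<close> and \<open>A' j\<close>. In
      \<open>A = A' + D\<close> the mixed terms pair to zero with \<open>z\<close>, because
      \<open>z\<close> and \<open>A'\<close> are block diagonal while \<open>D\<close> has zero
      pinching. The pairing with \<open>D * D\<close> is quadratic in \<open>L\<close>, since
      \<open>z\<close> is bounded in operator norm.\<close>
    have a_comm: "norm (r * (a i * a j - a j * a i)) \<le> \<delta>1 * s" if ij: "i \<in> J" "j \<in> J" for i j
    proof -
      define z where "z = a i * a j - a j * a i"
      have op_z: "op_bound 2 z"
        using op_bound_diff[OF op_bound_mult[OF op_a[OF ij(1)] op_a[OF ij(2)]] op_bound_mult[OF op_a[OF ij(2)] op_a[OF ij(1)]]]
        by (simp add: z_def)
      have z_idm: "z * idm n = z" "idm n * z = z"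
        using hermitianD[OF ha[OF ij(1)]] hermitianD[OF ha[OF ij(2)]]
        by (simp_all add: z_def right_diff_distrib left_diff_distrib mult.assoc) (simp_all add: mult.assoc[symmetric])
      have A'_p: "A' l * P.cell c m = P.cell c m * A' l" if "m \<in> c ` {..<n}" for l m
        unfolding A'_def by (rule C.pinch_commute_p[OF that])
      have a_p: "a l * P.cell c m = P.cell c m * a l" if "m \<in> c ` {..<n}" for l m
        unfolding a_def using A'_p[OF that] r_p(2)[OF that] by (metis mult.assoc)
      have z_p: "z * P.cell c m = P.cell c m * z" if "m \<in> c ` {..<n}" for m
        unfolding z_def right_diff_distrib left_diff_distrib using a_p[OF that] by (metis mult.assoc)
      have rrz: "r * (r * z) = A' i * A' j - A' j * A' i"
      proof -
        have "r * (r * (a i * a j)) = A' i * A' j" if "i \<in> J" "j \<in> J" for i j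
        proof -
          have "r * (r * (a i * a j)) = r * ((r * a i) * a j)" by (simp only: mult.assoc)
          also have "\<dots> = r * ((a i * r) * a j)" using ra[OF that(1)] ar[OF that(1)] by simp
          also have "\<dots> = (r * a i) * (r * a j)" by (simp only: mult.assoc)
          finally show ?thesis using ra that by simp
        qed
        then show ?thesis using ij by (simp add: z_def right_diff_distrib)
      qed
      have pinchD: "C.pinch (D l) = 0" for l
        by (simp add: D_def A'_def C.pinch_diff C.pinch_commuting C.pinch_commute_p)
      have zAA: "inner z (A l * A m) = inner z (A' l * A' m) + inner z (D l * D m)" if lm: "l \<in> J" "m \<in> J" for l m
      proof -
        have "inner z (A' l * D m) = inner (A' l * z) (D m)"
          using inner_mult_adj_left[of "A' l" z "D m"] hA'(1)[OF lm(1)] by simp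
        also have "A' l * z = C.pinch (A' l * z)"
          by (rule C.pinch_commuting[symmetric]) (use A'_p z_p z_idm in \<open>metis mult.assoc\<close>)+
        also have "inner (C.pinch (A' l * z)) (D m) = 0" by (simp add: C.inner_pinch pinchD)
        finally have 1: "inner z (A' l * D m) = 0" .
        have "inner z (D l * A' m) = inner (z * A' m) (D l)"
          using inner_mult_adj_right[of z "A' m" "D l"] hA'(1)[OF lm(2)] by simp
        also have "z * A' m = C.pinch (z * A' m)"
          by (rule C.pinch_commuting[symmetric]) (use A'_p z_p hA'(3)[OF lm(2)] in \<open>metis mult.assoc\<close>)+
        also have "inner (C.pinch (z * A' m)) (D l) = 0" by (simp add: C.inner_pinch pinchD)
        finally have 2: "inner z (D l * A' m) = 0" .
        have "A l * A m = A' l * A' m + A' l * D m + D l * A' m + D l * D m"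
          by (simp add: D_def algebra_simps)
        then show ?thesis using 1 2 by (simp add: inner_add_right)
      qed
      have zDD: "\<bar>inner z (D l * D m)\<bar> \<le> 2 * (L * s) * (L * s)" if lm: "l \<in> J" "m \<in> J" for l m
      proof -
        have "inner z (D l * D m) = inner (D l * z) (D m)"
          using inner_mult_adj_left[of "D l" z "D m"] hA'(1)[OF lm(1)] hA(1)[OF lm(1)] by (simp add: D_def)
        then have "\<bar>inner z (D l * D m)\<bar> \<le> norm (D l * z) * norm (D m)"
          by (simp add: Cauchy_Schwarz_ineq2)
        also have "\<dots> \<le> (2 * (L * s)) * (L * s)"
        proof (rule mult_mono)
          show "norm (D l * z) \<le> 2 * (L * s)"
            using op_bound_right[OF op_z, of "D l"] normD[OF lm(1)] by linarith
        qed (use normD lm L s0 in auto)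
        finally show ?thesis .
      qed
      have "norm z \<le> 2 * s"
        using op_boundD[OF op_z, of "idm n"] z_idm s by simp
      then have zc: "inner z (A i * A j - A j * A i) \<le> (2 * s) * (\<delta> * s)"
        using norm_cauchy_schwarz[of z "A i * A j - A j * A i"] comm[OF ij] s0
        by (meson mult_mono norm_ge_zero order_trans mult_nonneg_nonneg zero_le_numeral)
      have "(norm (r * z))\<^sup>2 = inner z (r * (r * z))"
        using hermitianD(1)[OF hr] by (simp add: power2_norm_eq_inner inner_mult_adj_left)
      also have "\<dots> = inner z (A i * A j - A j * A i) - inner z (D i * D j) + inner z (D j * D i)"
        using zAA[OF ij] zAA[OF ij(2,1)] by (simp add: rrz inner_diff_right)
      also have "\<dots> \<le> (2 * s) * (\<delta> * s) + 2 * (2 * (L * s) * (L * s))"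
        using zc zDD[OF ij] zDD[OF ij(2,1)] by linarith
      also have "\<dots> = (2 * \<delta> + 4 * L\<^sup>2) * s\<^sup>2" by (simp add: algebra_simps power2_eq_square)
      also have "\<dots> \<le> \<delta>1\<^sup>2 * s\<^sup>2" by (rule mult_right_mono) (use \<delta>(2) L2 zero_le_power2[of \<delta>1] in linarith, simp)
      finally have "(norm (r * z))\<^sup>2 \<le> (\<delta>1 * s)\<^sup>2" by (simp add: power_mult_distrib)
      then show ?thesis unfolding z_def by (rule power2_le_imp_le) (use \<delta>1 s0 in simp)
    qed
    have "\<exists>b. (\<forall>j\<in>J. hermitian n (b j) \<and> r * b j = b j * r) \<and>
      (\<forall>i\<in>J. \<forall>j\<in>J. b i * b j = b j * b i) \<and> (\<forall>j\<in>J. norm (r * (a j - b j)) \<le> \<epsilon> / 2 * s)"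
      by (rule bounded[rule_format]) (simp add: s0 hr normr ha op_a ra ar a_comm)
    then obtain b where b: "\<And>j. j \<in> J \<Longrightarrow> hermitian n (b j)" "\<And>j. j \<in> J \<Longrightarrow> r * b j = b j * r"
      "\<And>i j. i \<in> J \<Longrightarrow> j \<in> J \<Longrightarrow> b i * b j = b j * b i"
      "\<And>j. j \<in> J \<Longrightarrow> norm (r * (a j - b j)) \<le> \<epsilon> / 2 * s" by blast
    show "\<exists>B. (\<forall>j\<in>J. hermitian n (B j)) \<and> (\<forall>i\<in>J. \<forall>j\<in>J. B i * B j = B j * B i) \<and>
      (\<forall>j\<in>J. norm (A j - B j) \<le> \<epsilon> * s)"
    proof (rule exI[of _ "\<lambda>j. r * b j"], intro conjI ballI)
      fix j assume j: "j \<in> J"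
      note hb = hermitianD[OF b(1)[OF j]]
      show "hermitian n (r * b j)"
      proof (rule hermitianI)
        show "adj (r * b j) = r * b j" using hermitianD(1)[OF hr] hb b(2)[OF j] by simp
        show "idm n * (r * b j) = r * b j" using hermitianD(2)[OF hr] by (simp add: mult.assoc[symmetric])
        show "r * b j * idm n = r * b j" using hb by (simp add: mult.assoc)
      qed
      have "A j - r * b j = D j + r * (a j - b j)"
        using ra[OF j] by (simp add: D_def right_diff_distrib)
      then have "norm (A j - r * b j) \<le> norm (D j) + norm (r * (a j - b j))"
        by (simp add: norm_triangle_ineq)
      also have "\<dots> \<le> L * s + \<epsilon> / 2 * s" by (intro add_mono normD b j)
      also have "\<dots> \<le> \<epsilon> / 2 * s + \<epsilon> / 2 * s" using L s0 by (intro add_mono mult_right_mono) auto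
      finally show "norm (A j - r * b j) \<le> \<epsilon> * s" by simp
    next
      fix i j assume ij: "i \<in> J" "j \<in> J"
      have *: "r * b i * (r * b j) = r * r * (b i * b j)" if "i \<in> J" for i j
        using b(2)[OF that] by (metis mult.assoc)
      show "r * b i * (r * b j) = r * b j * (r * b i)"
        unfolding *[OF ij(1)] *[OF ij(2)] b(3)[OF ij] ..
    qed
  qed (rule \<delta>(1))
qed

subsection \<open>Normal and unitary matrices\<close>

definition normal :: "nat \<Rightarrow> fsmat \<Rightarrow> bool" where
  "normal n x \<longleftrightarrow> supp_below n x \<and> adj x * x = x * adj x"

definition unitary :: "nat \<Rightarrow> fsmat \<Rightarrow> bool" where
  "unitary n x \<longleftrightarrow> supp_below n x \<and> adj x * x = idm n \<and> x * adj x = idm n"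

text \<open>A quantitative Fuglede theorem for the Hilbert-Schmidt norm. Expanding both squared
  norms, the square terms agree by normality and the mixed ones by moving factors across the inner
  product.\<close>

lemma norm_commutator_adj:
  fixes x y :: "'a::hs_algebra"
  assumes "adj x * x = x * adj x"
  shows "norm (adj x * y - y * adj x) = norm (x * y - y * x)"
proof -
  have 1: "inner (adj x * y) (adj x * y) = inner (x * y) (x * y)"
    by (simp add: inner_mult_adj_left mult.assoc[symmetric] assms)
  have 2: "inner (y * adj x) (y * adj x) = inner (y * x) (y * x)"
    by (simp add: inner_mult_adj_right mult.assoc assms)
  have "inner (adj x * y) (y * adj x) = inner y (x * (y * adj x))"
    by (simp add: inner_mult_adj_left)
  also have "\<dots> = inner (y * x) (x * y)"
    by (simp add: inner_mult_adj_right mult.assoc)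
  finally have 3: "inner (adj x * y) (y * adj x) = inner (x * y) (y * x)"
    by (simp add: inner_commute)
  have 4: "inner (y * adj x) (adj x * y) = inner (y * x) (x * y)"
    using 3 by (simp only: inner_commute)
  have "(norm (adj x * y - y * adj x))\<^sup>2 = (norm (x * y - y * x))\<^sup>2"
    unfolding power2_norm_eq_inner inner_diff_left inner_diff_right 1 2 3 4 ..
  then show ?thesis by (simp add: power2_eq_iff_nonneg)
qed

text \<open>The commutator of \<open>u\<close> and \<open>v\<close> expands into four commutators of
  \<open>x\<close> or \<open>adj x\<close> with \<open>y\<close> or \<open>adj y\<close>. Each has
  coefficient of modulus 1/4 and, by normality, the same norm.\<close>

lemma norm_commutator_cscale_adj_le:
  assumes x: "adj x * x = x * adj x" and y: "adj y * y = y * adj y"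
    and c: "cmod c = 1 / 2" "cmod d = 1 / 2"
  defines "u \<equiv> cscale c x + cscale (cnj c) (adj x)"
    and "v \<equiv> cscale d y + cscale (cnj d) (adj y)"
  shows "norm (u * v - v * u) \<le> norm (x * y - y * x)"
proof -
  define K where "K = norm (x * y - y * x)"
  have xy: "norm (adj x * y - y * adj x) = K"
    unfolding K_def by (rule norm_commutator_adj[OF x])
  have swap: "norm (z * adj y - adj y * z) = norm (z * y - y * z)" for z
    using norm_commutator_adj[OF y, of z] by (metis norm_minus_commute)
  have "u * v - v * u = cscale (c * d) (x * y - y * x) + cscale (c * cnj d) (x * adj y - adj y * x)
      + cscale (cnj c * d) (adj x * y - y * adj x) + cscale (cnj c * cnj d) (adj x * adj y - adj y * adj x)"
    by (simp add: u_def v_def algebra_simps cscale_add_right cscale_diff_right)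
  then have "norm (u * v - v * u) \<le> norm (cscale (c * d) (x * y - y * x)) + norm (cscale (c * cnj d) (x * adj y - adj y * x))
      + norm (cscale (cnj c * d) (adj x * y - y * adj x)) + norm (cscale (cnj c * cnj d) (adj x * adj y - adj y * adj x))"
    by (simp only:) (intro order_trans[OF norm_triangle_ineq] add_mono order_refl)
  also have "\<dots> = K"
    by (simp add: norm_cscale norm_mult c swap xy) (simp add: K_def)
  finally show ?thesis by (simp add: K_def)
qed

text \<open>The Hermitian case is applied to all real and imaginary parts, indexed by
  \<open>J \<times> UNIV\<close>, with the same \<open>\<delta>\<close>. Commuting parts recombine
  to commuting normal matrices.\<close>

lemma normal_near_commuting:
  fixes J :: "'j set"
  assumes J: "finite J"
  shows "near_commuting normal J"
  unfolding near_commuting_def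
proof (intro allI impI)
  fix \<epsilon> :: real assume "\<epsilon> > 0"
  \<comment> \<open>The coefficient of \<open>N j\<close> in its real part for \<open>True\<close>
    and in its imaginary part for \<open>False\<close>; the adjoint enters with the conjugate
    coefficient.\<close>
  define part where "part t = (if t then 1 / 2 else - \<i> / 2)" for t :: bool
  have part: "cmod (part t) = 1 / 2" for t by (simp add: part_def)
  have "near_commuting hermitian (J \<times> (UNIV :: bool set))"
    using J by (intro hermitian_near_commuting) simp
  from near_commutingD[OF this half_gt_zero[OF \<open>\<epsilon> > 0\<close>]]
  obtain \<delta> where \<delta>: "\<delta> > 0" and near: "\<forall>n s. \<forall>A :: 'j \<times> bool \<Rightarrow> fsmat. norm (idm n) \<le> s \<and>
      (\<forall>j\<in>J \<times> UNIV. hermitian n (A j) \<and> norm (A j) \<le> s) \<and>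
      (\<forall>i\<in>J \<times> UNIV. \<forall>j\<in>J \<times> UNIV. norm (A i * A j - A j * A i) \<le> \<delta> * s) \<longrightarrow>
      (\<exists>B. (\<forall>j\<in>J \<times> UNIV. hermitian n (B j)) \<and> (\<forall>i\<in>J \<times> UNIV. \<forall>j\<in>J \<times> UNIV. B i * B j = B j * B i) \<and>
        (\<forall>j\<in>J \<times> UNIV. norm (A j - B j) \<le> \<epsilon> / 2 * s))"
    by (elim exE conjE)
  show "\<exists>\<delta>>0. \<forall>n s. \<forall>A :: 'j \<Rightarrow> fsmat. norm (idm n) \<le> s \<and> (\<forall>j\<in>J. normal n (A j) \<and> norm (A j) \<le> s) \<and>
      (\<forall>i\<in>J. \<forall>j\<in>J. norm (A i * A j - A j * A i) \<le> \<delta> * s) \<longrightarrow>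
      (\<exists>B. (\<forall>j\<in>J. normal n (B j)) \<and> (\<forall>i\<in>J. \<forall>j\<in>J. B i * B j = B j * B i) \<and>
        (\<forall>j\<in>J. norm (A j - B j) \<le> \<epsilon> * s))"
  proof (rule exI[of _ \<delta>], intro conjI allI impI)
    fix n s and N :: "'j \<Rightarrow> fsmat"
    assume *: "norm (idm n) \<le> s \<and> (\<forall>j\<in>J. normal n (N j) \<and> norm (N j) \<le> s) \<and>
      (\<forall>i\<in>J. \<forall>j\<in>J. norm (N i * N j - N j * N i) \<le> \<delta> * s)"
    define A where "A = (\<lambda>(j, t). cscale (part t) (N j) + cscale (cnj (part t)) (adj (N j)))"
    have hA: "hermitian n (A (j, t))" and nA: "norm (A (j, t)) \<le> s" if "j \<in> J" for j t
    proof -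
      have N: "supp_below n (N j)" "norm (N j) \<le> s" using * that by (auto simp: normal_def)
      show "hermitian n (A (j, t))"
        unfolding hermitian_def using N(1) by (auto simp: A_def supp_below_def add.commute)
      have "norm (A (j, t)) \<le> norm (cscale (part t) (N j)) + norm (cscale (cnj (part t)) (adj (N j)))"
        unfolding A_def by (simp add: norm_triangle_ineq)
      then show "norm (A (j, t)) \<le> s" using N(2) by (simp add: norm_cscale part)
    qed
    have cA: "norm (A (i, t) * A (j, u) - A (j, u) * A (i, t)) \<le> \<delta> * s" if "i \<in> J" "j \<in> J" for i j t u
    proof -
      have "norm (A (i, t) * A (j, u) - A (j, u) * A (i, t)) \<le> norm (N i * N j - N j * N i)"
        unfolding A_def prod.case by (rule norm_commutator_cscale_adj_le) (use * that part in \<open>auto simp: normal_def\<close>)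
      then show ?thesis using * that by force
    qed
    have "norm (idm n) \<le> s \<and> (\<forall>j\<in>J \<times> UNIV. hermitian n (A j) \<and> norm (A j) \<le> s) \<and>
      (\<forall>i\<in>J \<times> UNIV. \<forall>j\<in>J \<times> UNIV. norm (A i * A j - A j * A i) \<le> \<delta> * s)"
      using * hA nA cA by (intro conjI ballI) auto
    from near[THEN spec, THEN spec, THEN spec, THEN mp, OF this] obtain B where
      hB: "\<forall>j\<in>J \<times> UNIV. hermitian n (B j)" and
      cB: "\<forall>i\<in>J \<times> UNIV. \<forall>j\<in>J \<times> UNIV. B i * B j = B j * B i" and
      dB: "\<forall>j\<in>J \<times> UNIV. norm (A j - B j) \<le> \<epsilon> / 2 * s"
      by (elim exE conjE)
    have B: "hermitian n (B (j, t))" "i \<in> J \<Longrightarrow> B (i, t) * B (j, u) = B (j, u) * B (i, t)"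
      "norm (A (j, t) - B (j, t)) \<le> \<epsilon> / 2 * s" if "j \<in> J" for i j t u
      using hB[rule_format, of "(j, t)"] cB[rule_format, of "(i, t)" "(j, u)"] dB[rule_format, of "(j, t)"] that
      by simp_all
    show "\<exists>B. (\<forall>j\<in>J. normal n (B j)) \<and> (\<forall>i\<in>J. \<forall>j\<in>J. B i * B j = B j * B i) \<and>
        (\<forall>j\<in>J. norm (N j - B j) \<le> \<epsilon> * s)"
    proof (rule exI[of _ "\<lambda>j. B (j, True) + cscale \<i> (B (j, False))"], intro conjI ballI)
      fix j assume j: "j \<in> J"
      note h = hermitianD[OF B(1)[OF j, of True]] hermitianD[OF B(1)[OF j, of False]]
      show "normal n (B (j, True) + cscale \<i> (B (j, False)))"
        unfolding normal_def
      proof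
        show "supp_below n (B (j, True) + cscale \<i> (B (j, False)))"
          using h(4,8) by (auto simp: supp_below_def)
        show "adj (B (j, True) + cscale \<i> (B (j, False))) * (B (j, True) + cscale \<i> (B (j, False))) =
          (B (j, True) + cscale \<i> (B (j, False))) * adj (B (j, True) + cscale \<i> (B (j, False)))"
          using h(1,5) B(2)[OF j j, of True False] by (simp add: algebra_simps cscale_add_right)
      qed
      have "N j = A (j, True) + cscale \<i> (A (j, False))"
        by (rule fsmat_eqI) (simp add: A_def part_def algebra_simps)
      then have "N j - (B (j, True) + cscale \<i> (B (j, False)))
          = (A (j, True) - B (j, True)) + cscale \<i> (A (j, False) - B (j, False))"
        by (simp add: cscale_diff_right)
      then have "norm (N j - (B (j, True) + cscale \<i> (B (j, False))))
          \<le> norm (A (j, True) - B (j, True)) + norm (cscale \<i> (A (j, False) - B (j, False)))"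
        by (simp only: norm_triangle_ineq)
      also have "\<dots> \<le> \<epsilon> / 2 * s + \<epsilon> / 2 * s"
        unfolding norm_cscale using B(3)[OF j, of True] B(3)[OF j, of False] by simp
      finally show "norm (N j - (B (j, True) + cscale \<i> (B (j, False)))) \<le> \<epsilon> * s" by simp
    next
      fix i j assume ij: "i \<in> J" "j \<in> J"
      show "(B (i, True) + cscale \<i> (B (i, False))) * (B (j, True) + cscale \<i> (B (j, False))) =
        (B (j, True) + cscale \<i> (B (j, False))) * (B (i, True) + cscale \<i> (B (i, False)))"
        using B(2)[OF ij(2,1), of True True] B(2)[OF ij(2,1), of True False]
          B(2)[OF ij(2,1), of False True] B(2)[OF ij(2,1), of False False]
        by (simp only: distrib_left distrib_right cscale_mult_left cscale_mult_right cscale_add_right add_ac)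
    qed
  qed (rule \<delta>)
qed

text \<open>\<open>V\<close> replaces each eigenvalue of \<open>B\<close> by its phase, a function
  of \<open>B\<close>. It is nearest because all unitaries have the same norm and the inner product
  of \<open>B\<close> with any of them is at most the sum of the moduli of the eigenvalues, weighted
  by \<open>(norm (p a))\<^sup>2\<close>.\<close>

lemma exists_nearest_unitary:
  assumes B: "normal n B"
  obtains V where "unitary n V"
    "\<And>y. supp_below n y \<Longrightarrow> y * B = B * y \<Longrightarrow> y * V = V * y"
    "\<And>U. unitary n U \<Longrightarrow> norm (B - V) \<le> norm (B - U)"
proof -
  have B': "supp_below n B" "adj B * B = B * adj B" "idm n * B = B" "B * idm n = B"
    using B by (auto simp: normal_def supp_below_iff_idm)
  obtain p c where p: "proj_family (idm n) {..<n} p" "\<And>a. a < n \<Longrightarrow> p a \<noteq> 0"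
    "\<And>a. a < n \<Longrightarrow> B * p a = cscale (c a) (p a)" "\<And>a. a < n \<Longrightarrow> p a * B = cscale (c a) (p a)"
    using spectral_normal[OF B'(1,2)] by blast
  interpret P: proj_family "idm n" "{..<n}" p by (rule p(1))
  \<comment> \<open>The phase 1 on the kernel of \<open>B\<close> keeps \<open>V\<close> unitary
    there.\<close>
  define f where "f z = (if z = 0 then 1 else sgn z)" for z :: complex
  have f1: "cmod (f z) = 1" for z by (simp add: f_def norm_sgn)
  have ff: "cnj (f z) * f z = 1" for z
    using complex_norm_square[of "f z"] f1[of z] by (simp add: mult.commute)
  have fdist: "cmod (z - f z) = \<bar>cmod z - 1\<bar>" for z
  proof (cases "z = 0")
    case False
    have "z - f z = of_real (cmod z - 1) * sgn z"
      using False by (simp add: f_def sgn_eq field_simps)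
    then show ?thesis using False by (simp only: norm_mult norm_of_real norm_sgn) simp
  qed (simp add: f_def)
  define V where "V = (\<Sum>a<n. cscale (f (c a)) (p a))"
  have V_p: "V * p a = cscale (f (c a)) (p a)" and p_V: "p a * V = cscale (f (c a)) (p a)" if "a < n" for a
  proof -
    have "V * p a = (\<Sum>b<n. if b = a then cscale (f (c a)) (p a) else 0)"
      unfolding V_def sum_distrib_right by (intro sum.cong refl) (use that in \<open>simp add: P.p_mult\<close>)
    then show "V * p a = cscale (f (c a)) (p a)" using that by simp
    have "p a * V = (\<Sum>b<n. if b = a then cscale (f (c a)) (p a) else 0)"
      unfolding V_def sum_distrib_left by (intro sum.cong refl) (use that in \<open>simp add: P.p_mult\<close>)
    then show "p a * V = cscale (f (c a)) (p a)" using that by simp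
  qed
  have V_corner: "idm n * V = V" "V * idm n = V"
    unfolding V_def by (simp_all add: sum_distrib_left sum_distrib_right)
  have adjV: "adj V = (\<Sum>a<n. cscale (cnj (f (c a))) (p a))"
    unfolding V_def by (simp add: adj_sum P.adj_p)
  have V: "unitary n V"
    unfolding unitary_def
  proof (intro conjI)
    show "supp_below n V" using V_corner by (simp add: supp_below_iff_idm)
    show "adj V * V = idm n"
      unfolding adjV by (simp add: sum_distrib_right p_V ff P.sum_p)
    show "V * adj V = idm n"
      unfolding adjV by (simp add: sum_distrib_left V_p ff P.sum_p)
  qed
  have commute: "y * V = V * y" if y: "supp_below n y" "y * B = B * y" for y
  proof (rule P.corner_eqI)
    have y': "idm n * y = y" "y * idm n = y" using y by (auto simp: supp_below_iff_idm)
    show "idm n * (y * V) = y * V" "y * V * idm n = y * V" "idm n * (V * y) = V * y" "V * y * idm n = V * y"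
      using y' V_corner by (simp_all add: mult.assoc) (simp_all add: mult.assoc[symmetric])
    fix a b assume ab: "a \<in> {..<n}" "b \<in> {..<n}"
    have "p a * (y * B) * p b = p a * y * (B * p b)" "p a * (B * y) * p b = (p a * B) * y * p b"
      by (simp_all only: mult.assoc)
    then have "cscale (c b) (p a * y * p b) = cscale (c a) (p a * y * p b)"
      using ab y(2) by (simp add: p(3,4))
    then have "cscale (c b - c a) (p a * y * p b) = 0" by (simp add: cscale_diff_left)
    then have "cscale (f (c b)) (p a * y * p b) = cscale (f (c a)) (p a * y * p b)"
      by (auto simp: cscale_eq_0_iff)
    moreover have "p a * (y * V) * p b = p a * y * (V * p b)" "p a * (V * y) * p b = (p a * V) * y * p b"
      by (simp_all only: mult.assoc)
    ultimately show "p a * (y * V) * p b = p a * (V * y) * p b"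
      using ab by (simp add: V_p p_V)
  qed
  have norm_sum: "(norm (\<Sum>a<n. cscale (w a) (p a)))\<^sup>2 = (\<Sum>a<n. (cmod (w a))\<^sup>2 * (norm (p a))\<^sup>2)" for w
  proof -
    have "(\<Sum>a<n. cscale (w a) (p a)) = (\<Sum>a<n. p a * cscale (w a) (p a))" by simp
    then have "(norm (\<Sum>a<n. cscale (w a) (p a)))\<^sup>2 = (\<Sum>a<n. (norm (p a * cscale (w a) (p a)))\<^sup>2)"
      using P.norm_sum_sq[of "\<lambda>a. cscale (w a) (p a)"] by simp
    then show ?thesis by (simp add: norm_cscale power_mult_distrib)
  qed
  have B_sum: "B = (\<Sum>a<n. cscale (c a) (p a))"
    using P.x_e_eq_sum[of B] B'(4) p(3) by simp
  have nearest: "norm (B - V) \<le> norm (B - U)" if U: "unitary n U" for U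
  proof (rule power2_le_imp_le)
    have U': "adj U * U = idm n" "U * idm n = U" using U by (auto simp: unitary_def supp_below_iff_idm)
    have normU: "norm (U * x) = norm (idm n * x)" for x
    proof -
      have "(norm (U * x))\<^sup>2 = inner x (idm n * x)"
        by (simp add: power2_norm_eq_inner inner_mult_adj_left mult.assoc[symmetric] U'(1))
      also have "\<dots> = (norm (idm n * x))\<^sup>2"
        by (simp add: power2_norm_eq_inner inner_mult_adj_left mult.assoc[symmetric])
      finally show ?thesis by (simp add: power2_eq_iff_nonneg)
    qed
    have nU: "(norm U)\<^sup>2 = (\<Sum>a<n. (norm (p a))\<^sup>2)"
      using normU[of "idm n"] U'(2) norm_sum[of "\<lambda>_. 1"] P.sum_p by simp
    have "inner B U = (\<Sum>a<n. inner (cscale (c a) (p a)) U)"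
      unfolding B_sum by (simp add: inner_sum_left)
    also have "\<dots> \<le> (\<Sum>a<n. cmod (c a) * (norm (p a))\<^sup>2)"
    proof (rule sum_mono)
      fix a assume a: "a \<in> {..<n}"
      have "inner (cscale (c a) (p a)) U = inner (cscale (c a) (p a) * p a) U" using a by simp
      also have "\<dots> = inner (cscale (c a) (p a)) (U * p a)"
        unfolding inner_mult_adj_right using a by (simp add: P.adj_p)
      also have "\<dots> \<le> norm (cscale (c a) (p a)) * norm (U * p a)" by (rule norm_cauchy_schwarz)
      also have "\<dots> = cmod (c a) * (norm (p a))\<^sup>2"
        using a by (simp add: norm_cscale normU power2_eq_square)
      finally show "inner (cscale (c a) (p a)) U \<le> cmod (c a) * (norm (p a))\<^sup>2" .
    qed
    finally have inner_le: "inner B U \<le> (\<Sum>a<n. cmod (c a) * (norm (p a))\<^sup>2)" .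
    have "B - V = (\<Sum>a<n. cscale (c a - f (c a)) (p a))"
      unfolding B_sum V_def by (simp add: sum_subtractf cscale_diff_left)
    then have "(norm (B - V))\<^sup>2 = (\<Sum>a<n. (cmod (c a) - 1)\<^sup>2 * (norm (p a))\<^sup>2)"
      by (simp add: norm_sum fdist)
    also have "\<dots> = (norm B)\<^sup>2 - 2 * (\<Sum>a<n. cmod (c a) * (norm (p a))\<^sup>2) + (norm U)\<^sup>2"
      unfolding nU by (subst B_sum)
        (simp add: norm_sum power2_diff algebra_simps sum.distrib sum_subtractf sum_distrib_left)
    also have "\<dots> \<le> (norm B)\<^sup>2 - 2 * inner B U + (norm U)\<^sup>2" using inner_le by simp
    also have "\<dots> = (norm (B - U))\<^sup>2"
      by (simp add: power2_norm_eq_inner inner_diff_left inner_diff_right inner_commute[of U B])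
    finally show "(norm (B - V))\<^sup>2 \<le> (norm (B - U))\<^sup>2" .
  qed simp
  show ?thesis by (rule that[OF V commute nearest])
qed

text \<open>The unitary \<open>U j\<close> competes with the polar part \<open>V j\<close> of the
  normal approximant, so passing from \<open>B j\<close> to \<open>V j\<close> at most doubles the
  error.\<close>

lemma unitary_near_commuting:
  fixes J :: "'j set"
  assumes J: "finite J"
  shows "near_commuting unitary J"
  unfolding near_commuting_def
proof (intro allI impI)
  fix \<epsilon> :: real assume "\<epsilon> > 0"
  from near_commutingD[OF normal_near_commuting[OF J] half_gt_zero[OF this]]
  obtain \<delta> where \<delta>: "\<delta> > 0" and near: "\<forall>n s. \<forall>A :: 'j \<Rightarrow> fsmat. norm (idm n) \<le> s \<and>
      (\<forall>j\<in>J. normal n (A j) \<and> norm (A j) \<le> s) \<and>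
      (\<forall>i\<in>J. \<forall>j\<in>J. norm (A i * A j - A j * A i) \<le> \<delta> * s) \<longrightarrow>
      (\<exists>B. (\<forall>j\<in>J. normal n (B j)) \<and> (\<forall>i\<in>J. \<forall>j\<in>J. B i * B j = B j * B i) \<and>
        (\<forall>j\<in>J. norm (A j - B j) \<le> \<epsilon> / 2 * s))"
    by blast
  show "\<exists>\<delta>>0. \<forall>n s. \<forall>A :: 'j \<Rightarrow> fsmat. norm (idm n) \<le> s \<and> (\<forall>j\<in>J. unitary n (A j) \<and> norm (A j) \<le> s) \<and>
      (\<forall>i\<in>J. \<forall>j\<in>J. norm (A i * A j - A j * A i) \<le> \<delta> * s) \<longrightarrow>
      (\<exists>B. (\<forall>j\<in>J. unitary n (B j)) \<and> (\<forall>i\<in>J. \<forall>j\<in>J. B i * B j = B j * B i) \<and>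
        (\<forall>j\<in>J. norm (A j - B j) \<le> \<epsilon> * s))"
  proof (rule exI[of _ \<delta>], intro conjI allI impI)
    fix n s and U :: "'j \<Rightarrow> fsmat"
    assume *: "norm (idm n) \<le> s \<and> (\<forall>j\<in>J. unitary n (U j) \<and> norm (U j) \<le> s) \<and>
      (\<forall>i\<in>J. \<forall>j\<in>J. norm (U i * U j - U j * U i) \<le> \<delta> * s)"
    then have "\<forall>j\<in>J. normal n (U j)" by (simp add: normal_def unitary_def)
    with near[rule_format, of n s U] * obtain B where
      B: "\<And>j. j \<in> J \<Longrightarrow> normal n (B j)" "\<And>i j. i \<in> J \<Longrightarrow> j \<in> J \<Longrightarrow> B i * B j = B j * B i"
        "\<And>j. j \<in> J \<Longrightarrow> norm (U j - B j) \<le> \<epsilon> / 2 * s"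
      by blast
    have "\<forall>j\<in>J. \<exists>V. unitary n V \<and> (\<forall>y. supp_below n y \<longrightarrow> y * B j = B j * y \<longrightarrow> y * V = V * y) \<and>
      (\<forall>U. unitary n U \<longrightarrow> norm (B j - V) \<le> norm (B j - U))"
      using exists_nearest_unitary[OF B(1)] by metis
    then obtain V where V: "\<And>j. j \<in> J \<Longrightarrow> unitary n (V j)"
      "\<And>j y. j \<in> J \<Longrightarrow> supp_below n y \<Longrightarrow> y * B j = B j * y \<Longrightarrow> y * V j = V j * y"
      "\<And>j U. j \<in> J \<Longrightarrow> unitary n U \<Longrightarrow> norm (B j - V j) \<le> norm (B j - U)"
      by metis
    show "\<exists>B. (\<forall>j\<in>J. unitary n (B j)) \<and> (\<forall>i\<in>J. \<forall>j\<in>J. B i * B j = B j * B i) \<and>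
        (\<forall>j\<in>J. norm (U j - B j) \<le> \<epsilon> * s)"
    proof (rule exI[of _ V], intro conjI ballI)
      fix j assume j: "j \<in> J"
      show "unitary n (V j)" by (rule V(1)[OF j])
      have "U j - V j = (U j - B j) + (B j - V j)" by simp
      then have "norm (U j - V j) \<le> norm (U j - B j) + norm (B j - V j)" by (metis norm_triangle_ineq)
      also have "norm (B j - V j) \<le> norm (U j - B j)"
        using V(3)[OF j, of "U j"] * j by (simp add: norm_minus_commute)
      finally show "norm (U j - V j) \<le> \<epsilon> * s" using B(3)[OF j] by simp
    next
      fix i j assume ij: "i \<in> J" "j \<in> J"
      have "supp_below n (B i)" "supp_below n (V j)" using B(1)[OF ij(1)] V(1)[OF ij(2)]
        by (auto simp: normal_def unitary_def)
      \<comment> \<open>Commutation is transferred in two stages: first \<open>B j\<close> is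
        replaced by \<open>V j\<close>, then \<open>B i\<close> by \<open>V i\<close>.\<close>
      then have "B i * V j = V j * B i" by (intro V(2) ij B(2))
      then show "V i * V j = V j * V i" using V(2)[OF ij(1) \<open>supp_below n (V j)\<close>] by simp
    qed
  qed (rule \<delta>)
qed

subsection \<open>Transfer to matrices with fixed dimension\<close>

lemma tr_norm_le_iff:
  "n > 0 \<Longrightarrow> A \<in> carrier_mat n n \<Longrightarrow> tr_norm A \<le> c \<longleftrightarrow> norm (of_mat A) \<le> c * sqrt (real n)"
  by (simp add: tr_norm_eq divide_le_eq)

text \<open>The algebra statement is used with \<open>s = sqrt n\<close>. Since \<open>Q\<close>
  forces support below \<open>n\<close>, the approximants are again images of
  \<open>n \<times> n\<close> matrices.\<close>

lemma near_commuting_imp_matrices: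
  assumes near: "near_commuting Q J" and \<epsilon>: "\<epsilon> > 0"
    and S: "\<And>n A. A \<in> S n \<longleftrightarrow> A \<in> carrier_mat n n \<and> Q n (of_mat A)"
    and Q: "\<And>n x. Q n x \<Longrightarrow> supp_below n x"
  shows "\<exists>\<delta>>0. \<forall>n>0. \<forall>A :: 'j \<Rightarrow> complex mat.
    (\<forall>i\<in>J. A i \<in> S n) \<longrightarrow>
    (\<forall>i\<in>J. tr_norm (A i) \<le> 1) \<longrightarrow>
    (\<forall>i\<in>J. \<forall>j\<in>J. tr_norm (A i * A j - A j * A i) \<le> \<delta>) \<longrightarrow>
    (\<exists>B :: 'j \<Rightarrow> complex mat.
      (\<forall>i\<in>J. B i \<in> S n) \<and>
      (\<forall>i\<in>J. \<forall>j\<in>J. mat_commutator (B i) (B j) = 0\<^sub>m n n) \<and>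
      (\<forall>i\<in>J. tr_norm (A i - B i) \<le> \<epsilon>))"
proof -
  from near_commutingD[OF near \<epsilon>] obtain \<delta> where \<delta>: "\<delta> > 0" and *: "\<forall>n s. \<forall>A :: 'j \<Rightarrow> fsmat. norm (idm n) \<le> s \<and>
      (\<forall>j\<in>J. Q n (A j) \<and> norm (A j) \<le> s) \<and>
      (\<forall>i\<in>J. \<forall>j\<in>J. norm (A i * A j - A j * A i) \<le> \<delta> * s) \<longrightarrow>
      (\<exists>B. (\<forall>j\<in>J. Q n (B j)) \<and> (\<forall>i\<in>J. \<forall>j\<in>J. B i * B j = B j * B i) \<and>
        (\<forall>j\<in>J. norm (A j - B j) \<le> \<epsilon> * s))"
    by blast
  show ?thesis
  proof (rule exI[of _ \<delta>], intro conjI allI impI)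
    fix n :: nat and A :: "'j \<Rightarrow> complex mat"
    assume n: "n > 0" and A: "\<forall>i\<in>J. A i \<in> S n" "\<forall>i\<in>J. tr_norm (A i) \<le> 1"
      "\<forall>i\<in>J. \<forall>j\<in>J. tr_norm (A i * A j - A j * A i) \<le> \<delta>"
    have cA: "A i \<in> carrier_mat n n" if "i \<in> J" for i using A(1) S that by blast
    have idm: "norm (idm n) \<le> sqrt (real n)"
      by (rule real_le_rsqrt) (simp add: norm_idm_sq)
    have Qn: "\<forall>j\<in>J. Q n (of_mat (A j)) \<and> norm (of_mat (A j)) \<le> sqrt (real n)"
      using A(1,2) S tr_norm_le_iff[OF n cA, of _ 1] by auto
    have comm: "norm (of_mat (A i) * of_mat (A j) - of_mat (A j) * of_mat (A i)) \<le> \<delta> * sqrt (real n)"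
      if ij: "i \<in> J" "j \<in> J" for i j
    proof -
      have c: "A i * A j \<in> carrier_mat n n" "A j * A i \<in> carrier_mat n n"
        "A i * A j - A j * A i \<in> carrier_mat n n"
        using cA[OF ij(1)] cA[OF ij(2)] by (simp_all add: minus_carrier_mat)
      have "of_mat (A i * A j - A j * A i) = of_mat (A i) * of_mat (A j) - of_mat (A j) * of_mat (A i)"
        by (simp add: of_mat_diff[OF c(1,2)] of_mat_mult[OF cA cA] ij)
      then show ?thesis using A(3) ij tr_norm_le_iff[OF n c(3), of \<delta>] by simp
    qed
    obtain B where B: "\<And>j. j \<in> J \<Longrightarrow> Q n (B j)" "\<And>i j. i \<in> J \<Longrightarrow> j \<in> J \<Longrightarrow> B i * B j = B j * B i"
      "\<And>j. j \<in> J \<Longrightarrow> norm (of_mat (A j) - B j) \<le> \<epsilon> * sqrt (real n)"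
      using *[rule_format, of n "sqrt (real n)" "\<lambda>j. of_mat (A j)"] idm Qn comm by blast
    have "\<forall>j\<in>J. \<exists>C. C \<in> carrier_mat n n \<and> of_mat C = B j"
      using of_mat_surj[OF Q[OF B(1)]] by metis
    then obtain C where C: "\<And>j. j \<in> J \<Longrightarrow> C j \<in> carrier_mat n n" "\<And>j. j \<in> J \<Longrightarrow> of_mat (C j) = B j"
      by metis
    show "\<exists>B. (\<forall>i\<in>J. B i \<in> S n) \<and> (\<forall>i\<in>J. \<forall>j\<in>J. mat_commutator (B i) (B j) = 0\<^sub>m n n) \<and>
        (\<forall>i\<in>J. tr_norm (A i - B i) \<le> \<epsilon>)"
    proof (rule exI[of _ C], intro conjI ballI)
      fix i assume i: "i \<in> J"
      show "C i \<in> S n" using S C B(1) i by simp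
      have "A i - C i \<in> carrier_mat n n" by (rule minus_carrier_mat[OF C(1)[OF i]])
      then show "tr_norm (A i - C i) \<le> \<epsilon>"
        using B(3)[OF i] C(2)[OF i] of_mat_diff[OF cA[OF i] C(1)[OF i]] by (simp add: tr_norm_le_iff[OF n])
    next
      fix i j assume ij: "i \<in> J" "j \<in> J"
      have c: "C i * C j \<in> carrier_mat n n" "C j * C i \<in> carrier_mat n n"
        using C(1)[OF ij(1)] C(1)[OF ij(2)] by simp_all
      have "of_mat (C i * C j) = of_mat (C j * C i)"
        using B(2)[OF ij] C ij by (simp add: of_mat_mult[OF C(1) C(1)])
      then have "C i * C j = C j * C i" using of_mat_inject[OF c] by simp
      then show "mat_commutator (C i) (C j) = 0\<^sub>m n n"
        using c by (simp add: mat_commutator_def)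
    qed
  qed (rule \<delta>)
qed

section \<open>The three matrix classes under the embedding\<close>

lemma mat_adjoint_carrier: "A \<in> carrier_mat n n \<Longrightarrow> mat_adjoint A \<in> carrier_mat n n"
  by (rule carrier_matI) auto

lemma hermitian_matrices_iff:
  "A \<in> hermitian_matrices n \<longleftrightarrow> A \<in> carrier_mat n n \<and> hermitian n (of_mat A)"
proof (cases "A \<in> carrier_mat n n")
  case True
  have "mat_adjoint A = A \<longleftrightarrow> adj (of_mat A) = of_mat A"
    unfolding of_mat_adjoint[symmetric] using of_mat_inject[OF mat_adjoint_carrier[OF True] True] by simp
  then show ?thesis
    unfolding hermitian_matrices_def hermitian_def using True supp_below_of_mat[OF True] by blast
qed (simp add: hermitian_matrices_def)

lemma normal_matrices_iff:
  "A \<in> normal_matrices n \<longleftrightarrow> A \<in> carrier_mat n n \<and> normal n (of_mat A)"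
proof (cases "A \<in> carrier_mat n n")
  case True
  note c = mat_adjoint_carrier[OF True]
  have "mat_adjoint A * A = A * mat_adjoint A \<longleftrightarrow> adj (of_mat A) * of_mat A = of_mat A * adj (of_mat A)"
    using of_mat_inject[OF mult_carrier_mat[OF c True] mult_carrier_mat[OF True c]]
    unfolding of_mat_mult[OF c True] of_mat_mult[OF True c] of_mat_adjoint by (rule sym)
  then show ?thesis
    unfolding normal_matrices_def normal_def using True supp_below_of_mat[OF True] by blast
qed (simp add: normal_matrices_def)

lemma unitary_matrices_iff:
  "A \<in> unitary_matrices n \<longleftrightarrow> A \<in> carrier_mat n n \<and> unitary n (of_mat A)"
proof (cases "A \<in> carrier_mat n n")
  case True
  note c = mat_adjoint_carrier[OF True]
  have 1: "mat_adjoint A * A = 1\<^sub>m n \<longleftrightarrow> adj (of_mat A) * of_mat A = idm n"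
    using of_mat_inject[OF mult_carrier_mat[OF c True] one_carrier_mat]
    unfolding of_mat_mult[OF c True] of_mat_adjoint of_mat_one by (rule sym)
  have 2: "A * mat_adjoint A = 1\<^sub>m n \<longleftrightarrow> of_mat A * adj (of_mat A) = idm n"
    using of_mat_inject[OF mult_carrier_mat[OF True c] one_carrier_mat]
    unfolding of_mat_mult[OF True c] of_mat_adjoint of_mat_one by (rule sym)
  show ?thesis
    unfolding unitary_matrices_def unitary_def using True supp_below_of_mat[OF True] 1 2 by blast
qed (simp add: unitary_matrices_def)

theorem mainTheorem5:
  fixes S :: "nat \<Rightarrow> complex mat set" and k :: nat and \<epsilon> :: real
  assumes "S = hermitian_matrices \<or> S = unitary_matrices \<or> S = normal_matrices"
    and "k \<ge> 2"
    and "\<epsilon> > 0"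
  shows "\<exists>\<delta>>0. \<forall>n>0. \<forall>A :: nat \<Rightarrow> complex mat.
    (\<forall>i\<in>{1..k}. A i \<in> S n) \<longrightarrow>
    (\<forall>i\<in>{1..k}. tr_norm (A i) \<le> 1) \<longrightarrow>
    (\<forall>i\<in>{1..k}. \<forall>j\<in>{1..k}. tr_norm (A i * A j - A j * A i) \<le> \<delta>) \<longrightarrow>
    (\<exists>B :: nat \<Rightarrow> complex mat.
      (\<forall>i\<in>{1..k}. B i \<in> S n) \<and>
      (\<forall>i\<in>{1..k}. \<forall>j\<in>{1..k}. mat_commutator (B i) (B j) = 0\<^sub>m n n) \<and>
      (\<forall>i\<in>{1..k}. tr_norm (A i - B i) \<le> \<epsilon>))"
  using assms(1)
proof (elim disjE)
  assume S: "S = hermitian_matrices"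
  have "near_commuting hermitian {1..k}" by (rule hermitian_near_commuting) simp
  then show ?thesis
    unfolding S by (rule near_commuting_imp_matrices[OF _ assms(3) hermitian_matrices_iff]) (simp add: hermitian_def)
next
  assume S: "S = unitary_matrices"
  have "near_commuting unitary {1..k}" by (rule unitary_near_commuting) simp
  then show ?thesis
    unfolding S by (rule near_commuting_imp_matrices[OF _ assms(3) unitary_matrices_iff]) (simp add: unitary_def)
next
  assume S: "S = normal_matrices"
  have "near_commuting normal {1..k}" by (rule normal_near_commuting) simp
  then show ?thesis
    unfolding S by (rule near_commuting_imp_matrices[OF _ assms(3) normal_matrices_iff]) (simp add: normal_def)
qed

end
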